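(* Let $\phi:\mathbb{P}^1\to\mathbb{P}^1$ be a rational map defined over a global function field $K$ with exactly one prime of bad reduction, and let $\mathcal{C}\subset\mathbb{P}^1(K)$ be a cycle of $\phi$ of length $n>1$. Then for every fixed prime $\mathfrak p$ of $K$ at which $\phi$ has good reduction, the quantity $\delta_{\mathfrak p}(P,Q)$ is the same for all pairs $(P,Q)$ of distinct points of $\mathcal{C}$.
   Context: A global function field is a finite extension of $\mathbb{F}_p(t)$; its primes are its places, each with a discrete valuation $v_{\mathfrak p}$, valuation ring $R_{\mathfrak p}$, maximal ideal $\mathfrak p$. Write $\phi([X:Y])=[F:G]$ with $F,G$ coprime homogeneous polynomials over $K$ of degree $\deg\phi$; for a prime $\mathfrak p$, scale so all coefficients lie in $R_{\mathfrak p}$ and not all in $\mathfrak p$; $\phi$ has good reduction at $\mathfrak p$ if the homogeneous resultant $\mathrm{Res}(F,G)$ is a unit of $R_{\mathfrak p}$, and bad reduction otherwise. The $\mathfrak p$-adic logarithmic distance of $P_1=[x_1:y_1],P_2=[x_2:y_2]$ is $\delta_{\mathfrak p}(P_1,P_2)=v_{\mathfrak p}(x_1y_2-x_2y_1)-\min\{v_{\mathfrak p}(x_1),v_{\mathfrak p}(y_1)\}-\min\{v_{\mathfrak p}(x_2),v_{\mathfrak p}(y_2)\}$. A cycle is the forward orbit $\{\phi^i(P):i\geqslant0\}$ of a periodic point $P$; its length is its cardinality. *)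

theory Defs
  imports "HOL-Computational_Algebra.Polynomial" "Subresultants.Resultant_Prelim"
begin

text \<open>The field K is the whole type 'a. The subfield F_p(t) generated by t over the
  prime field.\<close>
definition rat_subfield :: "'a::field \<Rightarrow> 'a set" where
  "rat_subfield t = {poly (map_poly of_int f) t / poly (map_poly of_int g) t | f g.
                      poly (map_poly of_int g) t \<noteq> 0}"

definition transcendental_over_prime_field :: "'a::field \<Rightarrow> bool" where
  "transcendental_over_prime_field t \<longleftrightarrow>
     (\<forall>f :: int poly. poly (map_poly of_int f) t = 0 \<longrightarrow> map_poly (of_int :: int \<Rightarrow> 'a) f = 0)"

definition global_function_field :: "'a::field itself \<Rightarrow> bool" where
  "global_function_field _ \<longleftrightarrow>
     prime CHAR('a) \<and>
     (\<exists>t::'a. transcendental_over_prime_field t \<and>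
        (\<exists>B::'a set. finite B \<and>
           (\<forall>x::'a. \<exists>c. (\<forall>b\<in>B. c b \<in> rat_subfield t) \<and> x = (\<Sum>b\<in>B. c b * b))))"

text \<open>A prime of K is given by its normalized discrete valuation v : K* \<rightarrow> Z
  (surjective); by convention v 0 = 0 (the value at 0 is never used as a valuation).\<close>
definition place :: "('a::field \<Rightarrow> int) \<Rightarrow> bool" where
  "place v \<longleftrightarrow>
     v 0 = 0 \<and>
     (\<forall>x y. x \<noteq> 0 \<longrightarrow> y \<noteq> 0 \<longrightarrow> v (x * y) = v x + v y) \<and>
     (\<forall>x y. x \<noteq> 0 \<longrightarrow> y \<noteq> 0 \<longrightarrow> x + y \<noteq> 0 \<longrightarrow> v (x + y) \<ge> min (v x) (v y)) \<and>
     (\<forall>n::int. \<exists>x. x \<noteq> 0 \<and> v x = n)"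

definition in_valring :: "('a::field \<Rightarrow> int) \<Rightarrow> 'a \<Rightarrow> bool" where
  "in_valring v x \<longleftrightarrow> x = 0 \<or> v x \<ge> 0"

definition in_maxideal :: "('a::field \<Rightarrow> int) \<Rightarrow> 'a \<Rightarrow> bool" where
  "in_maxideal v x \<longleftrightarrow> x = 0 \<or> v x > 0"

definition is_valunit :: "('a::field \<Rightarrow> int) \<Rightarrow> 'a \<Rightarrow> bool" where
  "is_valunit v x \<longleftrightarrow> x \<noteq> 0 \<and> v x = 0"

text \<open>A homogeneous form of degree d, F(X,Y) = sum_{i<=d} a_i X^i Y^(d-i), is represented
  by its dehomogenization f = F(X,1), a univariate polynomial of degree at most d.\<close>
definition hform :: "nat \<Rightarrow> 'a::comm_ring_1 poly \<Rightarrow> 'a \<Rightarrow> 'a \<Rightarrow> 'a" where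
  "hform d f x y = (\<Sum>i\<le>d. coeff f i * x ^ i * y ^ (d - i))"

text \<open>Coprimality of the two binary forms F, G of degree d: they have no common
  non-constant factor; a common factor is either Y (both have X-degree < d) or a common
  non-constant factor of the dehomogenizations.\<close>
definition hcoprime :: "nat \<Rightarrow> 'a::field poly \<Rightarrow> 'a poly \<Rightarrow> bool" where
  "hcoprime d f g \<longleftrightarrow> degree f \<le> d \<and> degree g \<le> d \<and> coprime f g \<and>
      (degree f = d \<or> degree g = d)"

text \<open>Homogeneous resultant of two binary forms of degree d (Sylvester determinant with
  formal degrees d, d).\<close>
definition hres :: "nat \<Rightarrow> 'a::comm_ring_1 poly \<Rightarrow> 'a poly \<Rightarrow> 'a" where
  "hres d f g = resultant_sub d d f g"

definition good_reduction :: "('a::field \<Rightarrow> int) \<Rightarrow> nat \<Rightarrow> 'a poly \<Rightarrow> 'a poly \<Rightarrow> bool" where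
  "good_reduction v d f g \<longleftrightarrow>
     (\<exists>c::'a. c \<noteq> 0 \<and>
        (\<forall>i\<le>d. in_valring v (c * coeff f i) \<and> in_valring v (c * coeff g i)) \<and>
        (\<exists>i\<le>d. \<not> in_maxideal v (c * coeff f i) \<or> \<not> in_maxideal v (c * coeff g i)) \<and>
        is_valunit v (hres d (smult c f) (smult c g)))"

definition P1 :: "('a::field \<times> 'a) set" where
  "P1 = {(x, 1) | x. True} \<union> {(1, 0)}"

definition pnorm :: "'a::field \<times> 'a \<Rightarrow> 'a \<times> 'a" where
  "pnorm P = (if snd P \<noteq> 0 then (fst P / snd P, 1) else (1, 0))"

definition ratmap :: "nat \<Rightarrow> 'a::field poly \<Rightarrow> 'a poly \<Rightarrow> 'a \<times> 'a \<Rightarrow> 'a \<times> 'a" where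
  "ratmap d f g P = pnorm (hform d f (fst P) (snd P), hform d g (fst P) (snd P))"

definition periodic_point :: "('b \<Rightarrow> 'b) \<Rightarrow> 'b \<Rightarrow> bool" where
  "periodic_point \<phi> P \<longleftrightarrow> (\<exists>n\<ge>1. (\<phi> ^^ n) P = P)"

definition is_cycle :: "('b \<Rightarrow> 'b) \<Rightarrow> 'b set \<Rightarrow> bool" where
  "is_cycle \<phi> C \<longleftrightarrow> (\<exists>P. periodic_point \<phi> P \<and> C = {(\<phi> ^^ i) P | i. True})"

text \<open>min of v(x), v(y) with v(0) = infinity (for (x,y) \<noteq> (0,0)).\<close>
definition vmin :: "('a::field \<Rightarrow> int) \<Rightarrow> 'a \<Rightarrow> 'a \<Rightarrow> int" where
  "vmin v x y = (if x = 0 then v y else if y = 0 then v x else min (v x) (v y))"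

definition log_dist :: "('a::field \<Rightarrow> int) \<Rightarrow> 'a \<times> 'a \<Rightarrow> 'a \<times> 'a \<Rightarrow> int" where
  "log_dist v A B = v (fst A * snd B - fst B * snd A)
                      - vmin v (fst A) (snd A) - vmin v (fst B) (snd B)"

end

theory Submission
  imports Defs "HOL-Number_Theory.Cong"
begin

text \<open>At primes of good reduction the map does not decrease logarithmic distances, so on a cycle
  \<open>P_0, ..., P_(n-1)\<close> the distance \<open>\<delta>(P_i, P_j)\<close> equals some \<open>e (j - i)\<close>, and the
  ultrametric inequality gives \<open>e (m k) \<ge> e k\<close>. By the Pluecker relation, if two of the three products of
  opposite distances of four points have the same valuation at all good primes, then their quotient is a
  unit outside a single prime, hence algebraic over the prime field, and therefore the third product has the same
  valuation too. Applied to the points with indices \<open>0, 1, k, k + 1\<close>, where \<open>k\<close> is coprime to \<open>n\<close>,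
  this yields \<open>e 2 = e 1\<close> (for \<open>n = 4\<close> and \<open>n = 6\<close>, which have no such \<open>k\<close> other than \<open>\<plusminus>1\<close>, other quadruples
  do), and then \<open>e k = e 1\<close> by induction on \<open>k\<close>.

  A unit outside a single prime is algebraic because a transcendental element has both a zero and a pole.
  A zero of \<open>x\<close> comes from a maximal subring containing \<open>x\<close> but not its inverse: this is a
  valuation ring, and it is discrete because all elements satisfy equations of bounded degree over
  the rational functions in \<open>x\<close>, so that a fixed power of each of them is a power of \<open>x\<close> times a unit.\<close>

section \<open>Distances along a cycle\<close>

text \<open>\<open>V\<close> stands for the good places and \<open>e v k\<close> for the distance at
  \<open>v\<close> between cycle points whose indices differ by \<open>k\<close>. The axioms other
  than \<open>periodic\<close> exclude index differences divisible by \<open>n\<close>, where points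
  coincide. Only \<open>cross\<close> is global: an equality at all places of \<open>V\<close>
  yields another one at each of them. It encodes the Pluecker argument for the points with indices
  \<open>0\<close>, \<open>a\<close>, \<open>b\<close>, \<open>c\<close>.\<close>

locale cycle_distances =
  fixes V :: "'v set" and e :: "'v \<Rightarrow> int \<Rightarrow> int" and n :: int
  assumes n_gt_1: "n > 1"
    and sym: "\<And>v k. v \<in> V \<Longrightarrow> \<not> n dvd k \<Longrightarrow> e v (-k) = e v k"
    and periodic: "\<And>v k l. v \<in> V \<Longrightarrow> n dvd k - l \<Longrightarrow> e v k = e v l"
    and ultra: "\<And>v j k. v \<in> V \<Longrightarrow> \<not> n dvd j \<Longrightarrow> \<not> n dvd k \<Longrightarrow> \<not> n dvd j + k \<Longrightarrow>
                 min (e v j) (e v k) \<le> e v (j + k)"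
    and cross: "\<And>a b c v. \<not> n dvd a \<Longrightarrow> \<not> n dvd b \<Longrightarrow> \<not> n dvd c \<Longrightarrow>
                 \<not> n dvd b - a \<Longrightarrow> \<not> n dvd c - a \<Longrightarrow> \<not> n dvd c - b \<Longrightarrow>
                 (\<And>v. v \<in> V \<Longrightarrow> e v a + e v (c - b) = e v b + e v (c - a)) \<Longrightarrow> v \<in> V \<Longrightarrow>
                 e v c + e v (b - a) = e v a + e v (c - b)"
begin

lemma e_mult_ge:
  assumes "v \<in> V" "\<not> n dvd k" "\<not> n dvd int m * k"
  shows "e v k \<le> e v (int m * k)"
  using assms(3)
proof (induction m)
  case 0
  then show ?case by simp
next
  case (Suc m)
  show ?case
  proof (cases "n dvd int m * k")
    \<comment> \<open>\<open>ultra\<close> does not cover an intermediate sum divisible by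
      \<open>n\<close>, but then the sum starts afresh at \<open>k\<close>.\<close>
    case True
    have "e v (int (Suc m) * k) = e v k"
      using True by (intro periodic assms) (simp add: algebra_simps)
    then show ?thesis by simp
  next
    case False
    have "min (e v (int m * k)) (e v k) \<le> e v (int m * k + k)"
      using Suc.prems False assms by (intro ultra) (auto simp: algebra_simps)
    with Suc.IH[OF False] show ?thesis by (simp add: algebra_simps)
  qed
qed

text \<open>Extends \<open>e_mult_ge\<close> to congruences and to multipliers of either sign:
  \<open>c\<close> may be replaced by its residue modulo \<open>n\<close>, which is a natural
  number.\<close>

lemma e_dvd_ge:
  assumes "v \<in> V" "\<not> n dvd k" "\<not> n dvd l" "n dvd l - c * k"
  shows "e v k \<le> e v l"
proof -
  define m where "m = nat (c mod n)"
  have m: "int m = c mod n" using n_gt_1 by (simp add: m_def)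
  have "l - int m * k = (l - c * k) + n * ((c div n) * k)"
    unfolding m by (simp add: minus_div_mult_eq_mod[symmetric] algebra_simps)
  then have d: "n dvd l - int m * k"
    using assms(4) by (metis dvd_add dvd_triv_left)
  then have "\<not> n dvd int m * k"
    using assms(3) by (metis dvd_diff_right_iff diff_diff_eq2 add_diff_cancel dvd_diffD1 dvd_diff_commute)
  from e_mult_ge[OF assms(1,2) this] periodic[OF assms(1) d] show ?thesis by simp
qed

lemma abs_n_neq_1 [simp]: "\<bar>n\<bar> \<noteq> 1"
  using n_gt_1 by simp

lemma e_ge_e1: "v \<in> V \<Longrightarrow> \<not> n dvd k \<Longrightarrow> e v 1 \<le> e v k"
  by (rule e_dvd_ge[where c = k]) auto

text \<open>By Bezout, \<open>1\<close> is a multiple of \<open>b\<close> modulo \<open>n\<close>,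
  just as \<open>b\<close> is a multiple of \<open>1\<close>, so the inequality holds in both
  directions.\<close>

lemma e_coprime:
  assumes "v \<in> V" "coprime b n"
  shows "e v b = e v 1"
proof -
  obtain x y where "x * b + y * n = 1"
    using bezout_int[of b n] assms(2) by auto
  then have d: "1 - x * b = n * y" by (simp add: algebra_simps)
  have b: "\<not> n dvd b"
    using assms(2) abs_n_neq_1 by (metis coprime_commute coprime_absorb_left zdvd1_eq)
  have "e v b \<le> e v 1"
    using assms b d by (intro e_dvd_ge[where c = x]) auto
  with e_ge_e1[OF assms(1) b] show ?thesis by simp
qed

text \<open>This is \<open>cross\<close> with \<open>a = 1\<close>, \<open>b = 3\<close>,
  \<open>c = 2\<close>, whose conclusion reads \<open>2 * e v 2 = 2 * e v 1\<close>. The hypothesis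
  ranges over all of \<open>V\<close> because the premise of \<open>cross\<close> does.\<close>

lemma e2_from_e3:
  assumes "n > 3" "\<And>v. v \<in> V \<Longrightarrow> e v 3 = e v 1" "v \<in> V"
  shows "e v 2 = e v 1"
proof -
  have "e v 2 + e v (3 - 1) = e v 1 + e v (2 - 3)"
    using assms sym[of _ 1] by (intro cross) (auto dest: zdvd_imp_le)
  then show ?thesis using sym[of v 1] assms by simp
qed

lemma e2:
  assumes "n > 2" "v \<in> V"
  shows "e v 2 = e v 1"
proof -
  consider "odd n" | "n = 4" | "n = 6" | "even n" "n > 6"
  proof -
    have "odd n \<or> n = 4 \<or> n = 6 \<or> even n \<and> n > 6"
      using assms(1) by presburger
    then show ?thesis using that by blast
  qed
  then show ?thesis
  proof cases
    case 1
    then show ?thesis by (intro e_coprime assms) (auto simp: coprime_left_2_iff_odd)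
  next
    case 2
    show ?thesis
    proof (rule e2_from_e3)
      fix v assume v: "v \<in> V"
      have "e v 3 = e v (-1)" using 2 v by (intro periodic) auto
      then show "e v 3 = e v 1" using sym[OF v, of 1] by simp
    qed (use 2 assms in auto)
  next
    case 3
    have e4: "e v 4 = e v 2" if v: "v \<in> V" for v
    proof -
      have "e v 4 = e v (-2)" using 3 v by (intro periodic) auto
      then show ?thesis using sym[OF v, of 2] 3 by simp
    qed
    show ?thesis
    proof (rule e2_from_e3)
      fix v assume v: "v \<in> V"
      \<comment> \<open>For the points with indices \<open>0, 1, 4, 2\<close>, the premise of
        \<open>cross\<close> is \<open>e4\<close>; in the conclusion \<open>e v 2\<close> cancels
        and \<open>e v 3 = e v 1\<close> is left.\<close>
      have "e v 2 + e v (4 - 1) = e v 1 + e v (2 - 4)"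
        using e4 sym[of _ 2] 3 v by (intro cross) auto
      then show "e v 3 = e v 1" using sym[OF v, of 2] 3 by simp
    qed (use 3 assms in auto)
  next
    case 4
    then obtain m where m: "n = 2 * m" by blast
    \<comment> \<open>An odd number coprime to \<open>m\<close>, hence coprime to
      \<open>n = 2 * m\<close>, lying just above the middle. The bound \<open>n > 6\<close> is what
      gives \<open>b + 1 < n\<close>.\<close>
    define b where "b = (if even m then m + 1 else m + 2)"
    have "odd b" by (simp add: b_def)
    have cop: "coprime b m"
    proof (cases "even m")
      case True
      then show ?thesis
        using gcd_add1[of 1 m] by (simp add: b_def coprime_iff_gcd_eq_1 add.commute)
    next
      case False
      then have "coprime m 2" by simp
      then show ?thesis
        using False gcd_add1[of 2 m] by (simp add: b_def coprime_iff_gcd_eq_1 gcd.commute add.commute)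
    qed
    have "coprime b n"
      using \<open>odd b\<close> cop unfolding m by (simp add: coprime_right_2_iff_odd)
    have lt: "1 < b - 1" "b + 1 < n"
      using 4 m by (auto simp: b_def)
    have nd: "\<not> n dvd k" if "0 < k" "k < n" for k
      using that by (auto dest: zdvd_imp_le)
    have eb: "e v b = e v 1" if "v \<in> V" for v
      using e_coprime[OF that \<open>coprime b n\<close>] .
    \<comment> \<open>Both summands on the left are at least \<open>e v 1\<close>, so both are equal
      to it. As \<open>b + 1\<close> is an even index, \<open>e v 2\<close> is squeezed between
      \<open>e v 1\<close> and \<open>e v (b + 1)\<close>.\<close>
    have "e v (b + 1) + e v (b - 1) = e v 1 + e v (b + 1 - b)"
      using lt assms eb by (intro cross nd) auto
    moreover have "e v 1 \<le> e v (b - 1)" "e v 1 \<le> e v (b + 1)" "e v 1 \<le> e v 2"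
      using lt assms by (auto intro!: e_ge_e1 simp: nd)
    moreover have "e v 2 \<le> e v (b + 1)"
      using \<open>odd b\<close> lt assms by (intro e_dvd_ge[where c = "(b + 1) div 2"] nd) (auto elim: oddE)
    ultimately show ?thesis by simp
  qed
qed

text \<open>Strong induction with the points \<open>0, 1, k, k + 1\<close>: the value at index
  \<open>k\<close> gives the premise of \<open>cross\<close>, and the one at \<open>k - 1\<close>
  then isolates the new value at \<open>k + 1\<close>. The places are quantified inside, since the
  induction hypothesis is needed at all of them at once.\<close>

lemma e_const_upto:
  assumes "int k + 1 < n"
  shows "\<forall>v\<in>V. e v (int k + 1) = e v 1"
  using assms
proof (induction k rule: less_induct)
  case (less k)
  consider "k = 0" | "k = 1" | j where "k = Suc (Suc j)"
    by (metis One_nat_def not0_implies_Suc)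
  then show ?case
  proof cases
    case 1
    then show ?thesis by simp
  next
    case 2
    then show ?thesis using e2 less.prems by simp
  next
    case (3 j)
    have nd: "\<not> n dvd i" if "0 < i" "i < n" for i
      using that by (auto dest: zdvd_imp_le)
    have ek: "e v (int j + 2) = e v 1" "e v (int j + 1) = e v 1" if "v \<in> V" for v
      using less.IH[of "Suc j"] less.IH[of j] less.prems 3 that by (auto simp: algebra_simps)
    show ?thesis
    proof
      fix v assume v: "v \<in> V"
      have "e v (int j + 3) + e v ((int j + 2) - 1) = e v 1 + e v ((int j + 3) - (int j + 2))"
        using less.prems 3 ek v by (intro cross nd) (auto simp: add.commute)
      then show "e v (int k + 1) = e v 1"
        using ek[OF v] 3 by (simp add: algebra_simps)
    qed
  qed
qed

theorem e_const:
  assumes "v \<in> V" "\<not> n dvd k"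
  shows "e v k = e v 1"
proof -
  define j where "j = nat (k mod n - 1)"
  have "0 \<le> k mod n" "k mod n < n" "k mod n \<noteq> 0"
    using n_gt_1 assms by (auto simp: dvd_eq_mod_eq_0)
  then have j: "int j + 1 = k mod n" "int j + 1 < n"
    by (auto simp: j_def)
  have "e v k = e v (k mod n)"
    by (intro periodic assms) (simp add: minus_mod_eq_mult_div)
  then show ?thesis using e_const_upto[OF j(2)] assms j by simp
qed

end

section \<open>Places and logarithmic distance\<close>

context
  fixes v :: "'a::field \<Rightarrow> int"
  assumes v: "place v"
begin

lemma place_mult: "x \<noteq> 0 \<Longrightarrow> y \<noteq> 0 \<Longrightarrow> v (x * y) = v x + v y"
  using v by (auto simp: place_def)

lemma place_one [simp]: "v 1 = 0"
  using place_mult[of 1 1] by simp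

lemma place_minus [simp]: "v (- x) = v x"
proof (cases "x = 0")
  case False
  have "v (-1) = 0" using place_mult[of "-1" "-1"] by simp
  then show ?thesis using place_mult[of "-1" x] False by simp
qed simp

lemma place_inverse: "x \<noteq> 0 \<Longrightarrow> v (inverse x) = - v x"
  using place_mult[of x "inverse x"] by simp

lemma place_divide: "x \<noteq> 0 \<Longrightarrow> y \<noteq> 0 \<Longrightarrow> v (x / y) = v x - v y"
  using place_mult[of x "inverse y"] place_inverse[of y] by (simp add: field_simps)

lemma place_add: "x \<noteq> 0 \<Longrightarrow> y \<noteq> 0 \<Longrightarrow> x + y \<noteq> 0 \<Longrightarrow> min (v x) (v y) \<le> v (x + y)"
  using v by (auto simp: place_def)

lemma place_surj: "\<exists>x. x \<noteq> 0 \<and> v x = k"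
  using v by (auto simp: place_def)

lemma in_valring_zero [simp]: "in_valring v 0"
  and in_valring_one [simp]: "in_valring v 1"
  by (simp_all add: in_valring_def)

lemma in_valring_mult: "in_valring v x \<Longrightarrow> in_valring v y \<Longrightarrow> in_valring v (x * y)"
  by (cases "x = 0 \<or> y = 0") (auto simp: in_valring_def place_mult)

lemma in_valring_minus: "in_valring v x \<Longrightarrow> in_valring v (- x)"
  by (simp add: in_valring_def)

lemma in_valring_add: "in_valring v x \<Longrightarrow> in_valring v y \<Longrightarrow> in_valring v (x + y)"
  using place_add[of x y] by (cases "x = 0 \<or> y = 0 \<or> x + y = 0") (auto simp: in_valring_def)

lemma in_valring_diff: "in_valring v x \<Longrightarrow> in_valring v y \<Longrightarrow> in_valring v (x - y)"
  using in_valring_add[of x "- y"] in_valring_minus[of y] by simp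

lemma in_valring_power: "in_valring v x \<Longrightarrow> in_valring v (x ^ k)"
  by (induction k) (auto intro: in_valring_mult)

lemma in_valring_sum: "(\<And>i. i \<in> I \<Longrightarrow> in_valring v (h i)) \<Longrightarrow> in_valring v (\<Sum>i\<in>I. h i)"
  by (induction I rule: infinite_finite_induct) (auto intro: in_valring_add)

lemma in_valring_prod: "(\<And>i. i \<in> I \<Longrightarrow> in_valring v (h i)) \<Longrightarrow> in_valring v (\<Prod>i\<in>I. h i)"
  by (induction I rule: infinite_finite_induct) (auto intro: in_valring_mult)

lemma in_maxideal_zero [simp]: "in_maxideal v 0"
  by (simp add: in_maxideal_def)

lemma in_maxideal_add: "in_maxideal v x \<Longrightarrow> in_maxideal v y \<Longrightarrow> in_maxideal v (x + y)"
  using place_add[of x y] by (cases "x = 0 \<or> y = 0 \<or> x + y = 0") (auto simp: in_maxideal_def)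

lemma in_maxideal_sum: "(\<And>i. i \<in> I \<Longrightarrow> in_maxideal v (h i)) \<Longrightarrow> in_maxideal v (\<Sum>i\<in>I. h i)"
  by (induction I rule: infinite_finite_induct) (auto intro: in_maxideal_add)

lemma in_maxideal_mult: "in_valring v x \<Longrightarrow> in_maxideal v y \<Longrightarrow> in_maxideal v (x * y)"
  by (cases "x = 0 \<or> y = 0") (auto simp: in_maxideal_def in_valring_def place_mult)

lemma place_power: "x \<noteq> 0 \<Longrightarrow> v (x ^ k) = int k * v x"
  by (induction k) (auto simp: place_mult algebra_simps)

lemma vmin_mult:
  assumes "c \<noteq> 0" "(x, y) \<noteq> (0, 0)"
  shows "vmin v (c * x) (c * y) = v c + vmin v x y"
  using assms by (auto simp: vmin_def place_mult)

end

section \<open>Determinants of homogeneous coordinates and the logarithmic distance\<close>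

definition homdet :: "'a::field \<times> 'a \<Rightarrow> 'a \<times> 'a \<Rightarrow> 'a" where
  "homdet A B = fst A * snd B - fst B * snd A"

lemma homdet_commute: "homdet A B = - homdet B A"
  by (simp add: homdet_def)

lemma log_dist_homdet: "log_dist v A B = v (homdet A B) - vmin v (fst A) (snd A) - vmin v (fst B) (snd B)"
  by (simp add: log_dist_def homdet_def)

lemma log_dist_commute: "place v \<Longrightarrow> log_dist v A B = log_dist v B A"
  using homdet_commute[of A B] by (simp add: log_dist_homdet place_minus)

lemma homdet_P1_eq_0_iff: "A \<in> P1 \<Longrightarrow> B \<in> P1 \<Longrightarrow> homdet A B = 0 \<longleftrightarrow> A = B"
  by (auto simp: P1_def homdet_def)

lemma P1_nonzero: "A \<in> P1 \<Longrightarrow> (fst A, snd A) \<noteq> (0, 0)"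
  by (auto simp: P1_def)

lemma homdet_pluecker:
  "homdet A B * homdet C D - homdet A C * homdet B D + homdet A D * homdet B C = 0"
  by (simp add: homdet_def algebra_simps)

lemma vmin_le:
  "x \<noteq> 0 \<Longrightarrow> vmin v x y \<le> v x"
  "y \<noteq> 0 \<Longrightarrow> vmin v x y \<le> v y"
  by (auto simp: vmin_def)

text \<open>Since \<open>v 0 = 0\<close> by convention instead of infinity, the bounds on the two
  terms are only demanded when these are nonzero.\<close>

lemma place_linear_combination:
  assumes v: "place v" and "a * x + b * y \<noteq> 0"
    and "a * x \<noteq> 0 \<Longrightarrow> m \<le> v (a * x)" and "b * y \<noteq> 0 \<Longrightarrow> m \<le> v (b * y)"
  shows "m \<le> v (a * x + b * y)"
proof (cases "a * x = 0 \<or> b * y = 0")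
  case True
  then show ?thesis using assms(2-4) by force
next
  case False
  then have "min (v (a * x)) (v (b * y)) \<le> v (a * x + b * y)"
    using assms(2) by (intro place_add v) simp_all
  then show ?thesis using False assms(3,4) by simp
qed

text \<open>Three vectors of a plane satisfy a linear relation whose coefficients are their pairwise
  determinants. The relation is read in a coordinate where \<open>B\<close> attains its minimal
  valuation.\<close>

lemma log_dist_ultra:
  assumes v: "place v" and P1: "A \<in> P1" "B \<in> P1" "C \<in> P1" and neq: "A \<noteq> B" "B \<noteq> C" "A \<noteq> C"
  shows "min (log_dist v A B) (log_dist v B C) \<le> log_dist v A C"
proof -
  define m where "m P = vmin v (fst P) (snd P)" for P
  have nz: "homdet A B \<noteq> 0" "homdet B C \<noteq> 0" "homdet A C \<noteq> 0"
    using homdet_P1_eq_0_iff P1 neq by blast+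
  have ld: "log_dist v P Q = v (homdet P Q) - m P - m Q" for P Q
    by (simp add: log_dist_homdet m_def)
  have key: "min (log_dist v A B) (log_dist v B C) \<le> log_dist v A C"
    if b: "b \<noteq> 0" "v b = m B" and id: "homdet A C * b = a * homdet B C + c * homdet A B"
      and a: "a \<noteq> 0 \<Longrightarrow> m A \<le> v a" and c: "c \<noteq> 0 \<Longrightarrow> m C \<le> v c" for a b c
  proof -
    define M where "M = min (v (homdet B C) + m A) (v (homdet A B) + m C)"
    have "M \<le> v (a * homdet B C + c * homdet A B)"
    proof (rule place_linear_combination[OF v])
      show "a * homdet B C + c * homdet A B \<noteq> 0"
        using nz(3) b(1) by (simp flip: id)
      show "M \<le> v (a * homdet B C)" if "a * homdet B C \<noteq> 0"
        using that a by (simp add: place_mult[OF v] M_def)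
      show "M \<le> v (c * homdet A B)" if "c * homdet A B \<noteq> 0"
        using that c by (simp add: place_mult[OF v] M_def)
    qed
    then have "M \<le> v (homdet A C * b)"
      by (simp only: id)
    then have "M \<le> v (homdet A C) + m B"
      using b nz by (simp add: place_mult[OF v])
    then show ?thesis by (auto simp: M_def ld)
  qed
  have *: "homdet A C * fst B = fst A * homdet B C + fst C * homdet A B"
    "homdet A C * snd B = snd A * homdet B C + snd C * homdet A B"
    by (simp_all add: homdet_def algebra_simps)
  have "(fst B \<noteq> 0 \<and> v (fst B) = m B) \<or> (snd B \<noteq> 0 \<and> v (snd B) = m B)"
    using P1_nonzero[OF P1(2)] by (auto simp: m_def vmin_def min_def prod_eq_iff)
  then show ?thesis
  proof
    assume "fst B \<noteq> 0 \<and> v (fst B) = m B"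
    then show ?thesis
      using vmin_le(1) by (intro key[OF _ _ *(1)]) (auto simp: m_def)
  next
    assume "snd B \<noteq> 0 \<and> v (snd B) = m B"
    then show ?thesis
      using vmin_le(2) by (intro key[OF _ _ *(2)]) (auto simp: m_def)
  qed
qed

lemma pnorm_scale:
  assumes "A \<noteq> (0, 0)"
  obtains c where "c \<noteq> 0" "pnorm A = (c * fst A, c * snd A)"
proof (cases "snd A = 0")
  case True
  then show ?thesis using assms that[of "inverse (fst A)"] by (auto simp: pnorm_def prod_eq_iff)
next
  case False
  then show ?thesis using that[of "inverse (snd A)"] by (auto simp: pnorm_def field_simps)
qed

text \<open>Scaling a vector shifts the valuation of the determinant and \<open>vmin\<close>
  equally. This requires a nonzero determinant, because \<open>v 0 = 0\<close> does not change under
  scaling.\<close>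

lemma log_dist_pnorm:
  assumes v: "place v" and nz: "A \<noteq> (0, 0)" "B \<noteq> (0, 0)" and neq: "homdet A B \<noteq> 0"
  shows "log_dist v (pnorm A) (pnorm B) = log_dist v A B"
proof -
  obtain a where a: "a \<noteq> 0" "pnorm A = (a * fst A, a * snd A)"
    using pnorm_scale nz by blast
  obtain b where b: "b \<noteq> 0" "pnorm B = (b * fst B, b * snd B)"
    using pnorm_scale nz by blast
  have "homdet (pnorm A) (pnorm B) = (a * b) * homdet A B"
    by (simp add: a b homdet_def algebra_simps)
  then have "v (homdet (pnorm A) (pnorm B)) = v a + v b + v (homdet A B)"
    using a b neq by (simp add: place_mult[OF v])
  moreover have "vmin v (fst (pnorm A)) (snd (pnorm A)) = v a + vmin v (fst A) (snd A)"
    unfolding a fst_conv snd_conv using nz by (intro vmin_mult[OF v a(1)]) simp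
  moreover have "vmin v (fst (pnorm B)) (snd (pnorm B)) = v b + vmin v (fst B) (snd B)"
    unfolding b fst_conv snd_conv using nz by (intro vmin_mult[OF v b(1)]) simp
  ultimately show ?thesis by (simp add: log_dist_homdet)
qed

lemma pnorm_eq_if_homdet_0:
  assumes "A \<noteq> (0, 0)" "B \<noteq> (0, 0)" "homdet A B = 0"
  shows "pnorm A = pnorm B"
proof (cases "snd A = 0 \<or> snd B = 0")
  case True
  then show ?thesis using assms by (auto simp: homdet_def pnorm_def prod_eq_iff)
next
  case False
  then show ?thesis using assms(3) by (simp add: homdet_def pnorm_def frac_eq_eq)
qed

section \<open>Good reduction\<close>

lemma in_valring_det:
  assumes v: "place v" and A: "A \<in> carrier_mat n n"
    and "\<And>i j. i < n \<Longrightarrow> j < n \<Longrightarrow> in_valring v (A $$ (i, j))"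
  shows "in_valring v (det A)"
  unfolding det_def'[OF A]
proof (intro in_valring_sum in_valring_mult in_valring_prod v)
  fix p assume p: "p \<in> {p. p permutes {0..<n}}"
  show "in_valring v (signof p)"
    using in_valring_minus[OF v in_valring_one[OF v]] in_valring_one[OF v]
    by (simp add: sign_def)
  show "in_valring v (A $$ (i, p i))" if "i \<in> {0..<n}" for i
    using that p permutes_in_image[of p "{0..<n}" i] by (intro assms) auto
qed

lemma in_valring_cofactor:
  assumes v: "place v" and A: "A \<in> carrier_mat n n" and ij: "i < n" "j < n"
    and R: "\<And>i j. i < n \<Longrightarrow> j < n \<Longrightarrow> in_valring v (A $$ (i, j))"
  shows "in_valring v (cofactor A i j)"
proof -
  have "in_valring v (det (mat_delete A i j))"
  proof (rule in_valring_det[OF v mat_delete_carrier[OF A]])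
    fix k l assume "k < n - 1" "l < n - 1"
    then show "in_valring v (mat_delete A i j $$ (k, l))"
      using A ij by (auto simp: mat_delete_def intro!: R)
  qed
  then show ?thesis
    unfolding cofactor_def
    by (intro in_valring_mult in_valring_power in_valring_minus in_valring_one v)
qed

lemma in_maxideal_valunit_mult:
  assumes "place v" "is_valunit v u"
  shows "in_maxideal v (u * x) \<longleftrightarrow> in_maxideal v x"
  using assms by (cases "x = 0") (auto simp: in_maxideal_def is_valunit_def place_mult)

lemma in_maxideal_powerD:
  assumes "place v" "in_maxideal v (x ^ k)"
  shows "in_maxideal v x"
  using assms by (cases "x = 0") (auto simp: in_maxideal_def place_power zero_less_mult_iff)

text \<open>The rows of the Sylvester matrix are the coefficient vectors of the monomial multiples
  of the two forms in degree \<open>2 * d - 1\<close>; applied to the vector of all monomials of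
  that degree, they evaluate these multiples.\<close>

lemma sylvester_mat_sub_mult_monomials:
  fixes f g :: "'a::comm_ring_1 poly" and x y :: 'a and d i :: nat
  defines "w \<equiv> vec (d + d) (\<lambda>j. x ^ (d + d - 1 - j) * y ^ j)"
  assumes i: "i < d + d"
  shows "(sylvester_mat_sub d d f g *\<^sub>v w) $ i =
    (if i < d then x ^ (d - 1 - i) * y ^ i * hform d f x y
     else x ^ (d + d - 1 - i) * y ^ (i - d) * hform d g x y)"
proof -
  let ?S = "sylvester_mat_sub d d f g"
  have lhs: "(?S *\<^sub>v w) $ i = (\<Sum>j<d + d. ?S $$ (i, j) * (x ^ (d + d - 1 - j) * y ^ j))"
    using i by (simp add: w_def scalar_prod_def lessThan_atLeast0)
  show ?thesis
  proof (cases "i < d")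
    case True
    have "(\<Sum>j<d + d. ?S $$ (i, j) * (x ^ (d + d - 1 - j) * y ^ j)) =
          (\<Sum>j\<in>{i..i + d}. coeff f (d + i - j) * (x ^ (d + d - 1 - j) * y ^ j))"
      using True i by (intro sum.mono_neutral_cong_right) (auto simp: sylvester_mat_sub_index)
    also have "\<dots> = (\<Sum>k\<le>d. coeff f k * (x ^ (d - 1 - i + k) * y ^ (i + (d - k))))"
      using True by (intro sum.reindex_bij_witness[of _ "\<lambda>k. d + i - k" "\<lambda>j. d + i - j"])
        (auto intro!: arg_cong2[of _ _ _ _ "(*)"] arg_cong[of _ _ "\<lambda>k. _ ^ k"])
    also have "\<dots> = x ^ (d - 1 - i) * y ^ i * hform d f x y"
      unfolding hform_def sum_distrib_left power_add by (intro sum.cong refl) (simp add: mult_ac)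
    finally show ?thesis using True lhs by simp
  next
    case False
    have "(\<Sum>j<d + d. ?S $$ (i, j) * (x ^ (d + d - 1 - j) * y ^ j)) =
          (\<Sum>j\<in>{i - d..i}. coeff g (i - j) * (x ^ (d + d - 1 - j) * y ^ j))"
      using False i by (intro sum.mono_neutral_cong_right) (auto simp: sylvester_mat_sub_index)
    also have "\<dots> = (\<Sum>k\<le>d. coeff g k * (x ^ (d + d - 1 - i + k) * y ^ (i - d + (d - k))))"
      using False i by (intro sum.reindex_bij_witness[of _ "\<lambda>k. i - k" "\<lambda>j. i - j"])
        (auto intro!: arg_cong2[of _ _ _ _ "(*)"] arg_cong[of _ _ "\<lambda>k. _ ^ k"])
    also have "\<dots> = x ^ (d + d - 1 - i) * y ^ (i - d) * hform d g x y"
      unfolding hform_def sum_distrib_left power_add by (intro sum.cong refl) (simp add: mult_ac)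
    finally show ?thesis using False lhs by simp
  qed
qed

text \<open>Multiplying the preceding evaluation by the adjugate shows that the resultant times any
  monomial of degree \<open>2 * d - 1\<close> lies in the ideal of the two forms, with coefficients
  built from cofactors and hence integral wherever the forms are.\<close>

lemma hres_mult_monomial:
  fixes f g :: "'a::comm_ring_1 poly"
  assumes k: "k < d + d"
  shows "hres d f g * (x ^ (d + d - 1 - k) * y ^ k) =
    (\<Sum>i<d + d. adj_mat (sylvester_mat_sub d d f g) $$ (k, i) *
      (if i < d then x ^ (d - 1 - i) * y ^ i * hform d f x y
       else x ^ (d + d - 1 - i) * y ^ (i - d) * hform d g x y))"
proof -
  let ?S = "sylvester_mat_sub d d f g"
  let ?w = "vec (d + d) (\<lambda>j. x ^ (d + d - 1 - j) * y ^ j)"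
  have S: "?S \<in> carrier_mat (d + d) (d + d)" by (rule sylvester_mat_sub_carrier)
  note adj = adj_mat[OF S]
  have "adj_mat ?S *\<^sub>v (?S *\<^sub>v ?w) = (adj_mat ?S * ?S) *\<^sub>v ?w"
    by (rule assoc_mult_mat_vec[symmetric, OF adj(1) S]) simp
  also have "\<dots> = (det ?S \<cdot>\<^sub>m 1\<^sub>m (d + d)) *\<^sub>v ?w"
    by (simp only: adj(3))
  also have "\<dots> = det ?S \<cdot>\<^sub>v (1\<^sub>m (d + d) *\<^sub>v ?w)"
    by auto
  also have "\<dots> = det ?S \<cdot>\<^sub>v ?w"
    by (subst one_mult_mat_vec) auto
  finally have "(adj_mat ?S *\<^sub>v (?S *\<^sub>v ?w)) $ k = det ?S * ?w $ k"
    using k by simp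
  then have "hres d f g * ?w $ k = (adj_mat ?S *\<^sub>v (?S *\<^sub>v ?w)) $ k"
    by (simp add: hres_def resultant_sub_def)
  also have "\<dots> = (\<Sum>i<d + d. adj_mat ?S $$ (k, i) * (?S *\<^sub>v ?w) $ i)"
    using k adj(1) by (simp add: scalar_prod_def lessThan_atLeast0)
  also have "\<dots> = (\<Sum>i<d + d. adj_mat ?S $$ (k, i) *
      (if i < d then x ^ (d - 1 - i) * y ^ i * hform d f x y
       else x ^ (d + d - 1 - i) * y ^ (i - d) * hform d g x y))"
    by (intro sum.cong refl arg_cong2[of _ _ _ _ "(*)"] sylvester_mat_sub_mult_monomials) simp
  finally show ?thesis
    using k by simp
qed

text \<open>Coordinates that reduce to a point of the projective line over the residue field. For
  them \<open>vmin\<close> vanishes, so \<open>log_dist\<close> is just the valuation of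
  \<open>homdet\<close>.\<close>

definition primitive_coords :: "('a::field \<Rightarrow> int) \<Rightarrow> 'a \<Rightarrow> 'a \<Rightarrow> bool" where
  "primitive_coords v x y \<longleftrightarrow> in_valring v x \<and> in_valring v y \<and> \<not> (in_maxideal v x \<and> in_maxideal v y)"

lemma primitive_coords_vmin: "primitive_coords v x y \<Longrightarrow> vmin v x y = 0"
  by (auto simp: primitive_coords_def vmin_def in_valring_def in_maxideal_def)

lemma primitive_coords_nonzero: "primitive_coords v x y \<Longrightarrow> (x, y) \<noteq> (0, 0)"
  by (auto simp: primitive_coords_def in_maxideal_def)

lemma primitive_coords_exist:
  assumes v: "place v" and "(x, y) \<noteq> (0, 0)"
  obtains t where "t \<noteq> 0" "primitive_coords v (t * x) (t * y)"
proof -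
  obtain t where t: "t \<noteq> 0" "v t = - vmin v x y"
    using place_surj[OF v] by blast
  have "primitive_coords v (t * x) (t * y)"
    using assms t by (auto simp: primitive_coords_def vmin_def in_valring_def in_maxideal_def place_mult[OF v] split: if_splits)
  with t that show ?thesis by blast
qed

lemma in_valring_hform:
  assumes v: "place v" and "\<And>i. i \<le> d \<Longrightarrow> in_valring v (coeff f i)" "in_valring v x" "in_valring v y"
  shows "in_valring v (hform d f x y)"
  unfolding hform_def using assms
  by (intro in_valring_sum in_valring_mult in_valring_power v) auto

text \<open>The reduced forms have no common zero: if both values were in the maximal ideal, so
  would be the resultant times \<open>x ^ (2 * d - 1)\<close> and times
  \<open>y ^ (2 * d - 1)\<close>, and the resultant is a unit.\<close>

lemma primitive_coords_hform:
  assumes v: "place v" and d: "d > 0"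
    and f: "\<And>i. i \<le> d \<Longrightarrow> in_valring v (coeff f i)"
    and g: "\<And>i. i \<le> d \<Longrightarrow> in_valring v (coeff g i)"
    and unit: "is_valunit v (hres d f g)"
    and xy: "primitive_coords v x y"
  shows "primitive_coords v (hform d f x y) (hform d g x y)"
proof -
  let ?S = "sylvester_mat_sub d d f g"
  have R: "in_valring v x" "in_valring v y"
    using xy by (auto simp: primitive_coords_def)
  have False if m: "in_maxideal v (hform d f x y)" "in_maxideal v (hform d g x y)"
  proof -
    have S: "in_valring v (?S $$ (i, j))" if "i < d + d" "j < d + d" for i j
      using that f g v by (auto simp: sylvester_mat_sub_index)
    have adj: "in_valring v (adj_mat ?S $$ (k, i))" if "k < d + d" "i < d + d" for i k
      using that S by (auto simp: adj_mat_def intro!: in_valring_cofactor[OF v sylvester_mat_sub_carrier])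
    have *: "in_maxideal v (hres d f g * (x ^ (d + d - 1 - k) * y ^ k))" if k: "k < d + d" for k
      unfolding hres_mult_monomial[OF k] using R m k adj
      by (auto intro!: in_maxideal_sum[OF v] in_maxideal_mult[OF v] in_valring_mult[OF v] in_valring_power[OF v])
    \<comment> \<open>The first and the last monomial are the pure powers of \<open>x\<close> and of
      \<open>y\<close>.\<close>
    have "in_maxideal v (x ^ (d + d - 1))" "in_maxideal v (y ^ (d + d - 1))"
      using *[of 0] *[of "d + d - 1"] unit d by (simp_all add: in_maxideal_valunit_mult[OF v])
    then have "in_maxideal v x" "in_maxideal v y"
      by (auto dest: in_maxideal_powerD[OF v])
    with xy show False by (simp add: primitive_coords_def)
  qed
  with in_valring_hform[OF v f R] in_valring_hform[OF v g R] show ?thesis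
    by (auto simp: primitive_coords_def)
qed

text \<open>After removing the common monomial factor, what remains is a difference of
  \<open>k\<close>-th powers of \<open>x1 * y2\<close> and \<open>x2 * y1\<close>, with
  \<open>k = i - j\<close>.\<close>

lemma monomial_homdet_dvd:
  fixes x1 :: "'a::field"
  assumes v: "place v" and R: "in_valring v x1" "in_valring v y1" "in_valring v x2" "in_valring v y2"
    and ij: "i \<le> d" "j \<le> i"
  shows "\<exists>h. in_valring v h \<and>
    x1 ^ i * y1 ^ (d - i) * (x2 ^ j * y2 ^ (d - j)) - x2 ^ i * y2 ^ (d - i) * (x1 ^ j * y1 ^ (d - j)) =
    (x1 * y2 - x2 * y1) * h"
proof -
  define a where "a = x1 * y2"
  define b where "b = x2 * y1"
  define k where "k = i - j"
  define h where "h = (\<Sum>l<k. b ^ (k - Suc l) * a ^ l)"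
  have ab: "a ^ k - b ^ k = (a - b) * h"
    unfolding h_def by (rule power_diff_sumr2)
  have e: "i = j + k" "d - j = (d - i) + k" using ij by (auto simp: k_def)
  have "x1 ^ i * y1 ^ (d - i) * (x2 ^ j * y2 ^ (d - j)) - x2 ^ i * y2 ^ (d - i) * (x1 ^ j * y1 ^ (d - j)) =
     (x1 * x2) ^ j * (y1 * y2) ^ (d - i) * (a ^ k - b ^ k)"
    unfolding a_def b_def e(2) power_add power_mult_distrib
    by (subst (1 3) e(1)) (simp add: power_add algebra_simps)
  also have "\<dots> = (x1 * y2 - x2 * y1) * ((x1 * x2) ^ j * (y1 * y2) ^ (d - i) * h)"
    unfolding ab by (simp add: a_def b_def)
  finally show ?thesis
    using R v unfolding h_def a_def b_def
    by (intro exI[of _ "(x1 * x2) ^ j * (y1 * y2) ^ (d - i) * h"] conjI)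
       (auto simp: h_def a_def b_def intro!: in_valring_sum[OF v] in_valring_mult[OF v] in_valring_power[OF v])
qed

text \<open>The expression on the left is alternating in the two points. Expanding it into pairs of
  monomials reduces it to \<open>monomial_homdet_dvd\<close>, where pairs with \<open>i < j\<close>
  follow by exchanging \<open>i\<close> and \<open>j\<close> up to sign.\<close>

lemma hform_homdet_dvd:
  fixes x1 :: "'a::field"
  assumes v: "place v" and R: "in_valring v x1" "in_valring v y1" "in_valring v x2" "in_valring v y2"
    and f: "\<And>i. i \<le> d \<Longrightarrow> in_valring v (coeff f i)"
    and g: "\<And>i. i \<le> d \<Longrightarrow> in_valring v (coeff g i)"
  shows "\<exists>h. in_valring v h \<and>
    hform d f x1 y1 * hform d g x2 y2 - hform d f x2 y2 * hform d g x1 y1 = (x1 * y2 - x2 * y1) * h"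
proof -
  define m where "m i j = x1 ^ i * y1 ^ (d - i) * (x2 ^ j * y2 ^ (d - j))
    - x2 ^ i * y2 ^ (d - i) * (x1 ^ j * y1 ^ (d - j))" for i j
  have "\<exists>h. in_valring v h \<and> m i j = (x1 * y2 - x2 * y1) * h" if ij: "i \<le> d" "j \<le> d" for i j
  proof (cases "j \<le> i")
    case True
    then show ?thesis unfolding m_def using monomial_homdet_dvd[OF v R ij(1)] by blast
  next
    case False
    then obtain h where h: "in_valring v h" "m j i = (x1 * y2 - x2 * y1) * h"
      using monomial_homdet_dvd[OF v R ij(2), of i] unfolding m_def by auto
    have "m i j = - m j i" by (simp add: m_def algebra_simps)
    with h show ?thesis by (intro exI[of _ "- h"]) (simp add: in_valring_minus[OF v])
  qed
  then obtain h where h: "\<And>i j. i \<le> d \<Longrightarrow> j \<le> d \<Longrightarrow> in_valring v (h i j)"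
    "\<And>i j. i \<le> d \<Longrightarrow> j \<le> d \<Longrightarrow> m i j = (x1 * y2 - x2 * y1) * h i j"
    by metis
  have "hform d f x1 y1 * hform d g x2 y2 - hform d f x2 y2 * hform d g x1 y1 =
      (\<Sum>i\<le>d. \<Sum>j\<le>d. coeff f i * coeff g j * m i j)"
    unfolding hform_def sum_product sum_subtractf[symmetric]
    by (intro sum.cong refl) (simp add: m_def algebra_simps)
  also have "\<dots> = (\<Sum>i\<le>d. \<Sum>j\<le>d. (x1 * y2 - x2 * y1) * (coeff f i * coeff g j * h i j))"
    by (intro sum.cong refl) (simp add: h)
  also have "\<dots> = (x1 * y2 - x2 * y1) * (\<Sum>i\<le>d. \<Sum>j\<le>d. coeff f i * coeff g j * h i j)"
    by (simp add: sum_distrib_left)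
  finally have "hform d f x1 y1 * hform d g x2 y2 - hform d f x2 y2 * hform d g x1 y1 =
      (x1 * y2 - x2 * y1) * (\<Sum>i\<le>d. \<Sum>j\<le>d. coeff f i * coeff g j * h i j)" .
  moreover have "in_valring v (\<Sum>i\<le>d. \<Sum>j\<le>d. coeff f i * coeff g j * h i j)"
    using f g h(1) by (intro in_valring_sum in_valring_mult v) auto
  ultimately show ?thesis by blast
qed

lemma hform_scale: "hform d f (t * x) (t * y) = t ^ d * hform d f x y" for t :: "'a::comm_ring_1"
proof -
  have "coeff f i * (t * x) ^ i * (t * y) ^ (d - i) = t ^ d * (coeff f i * x ^ i * y ^ (d - i))"
    if "i \<le> d" for i
    using that power_add[of t i "d - i"] by (simp add: power_mult_distrib mult_ac)
  then show ?thesis unfolding hform_def by (simp add: sum_distrib_left)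
qed

lemma hform_smult: "hform d (smult c f) x y = c * hform d f x y"
  by (simp add: hform_def sum_distrib_left mult_ac)

lemma pnorm_mult: "c \<noteq> 0 \<Longrightarrow> pnorm (c * x, c * y) = pnorm (x, y)"
  by (simp add: pnorm_def)

lemma ratmap_smult:
  assumes "c \<noteq> 0"
  shows "ratmap d (smult c f) (smult c g) = ratmap d f g"
  using pnorm_mult[OF assms] by (simp add: ratmap_def hform_smult fun_eq_iff)

lemma log_dist_scale:
  assumes "place v" "s \<noteq> 0" "t \<noteq> 0" "A \<noteq> (0, 0)" "B \<noteq> (0, 0)" "homdet A B \<noteq> 0"
  shows "log_dist v (s * fst A, s * snd A) (t * fst B, t * snd B) = log_dist v A B"
proof -
  have "homdet (s * fst A, s * snd A) (t * fst B, t * snd B) = s * t * homdet A B"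
    by (simp add: homdet_def algebra_simps)
  then show ?thesis
    using assms by (simp add: log_dist_homdet place_mult vmin_mult prod_eq_iff)
qed

text \<open>In primitive coordinates both distances are valuations of determinants, since good
  reduction keeps image coordinates primitive, and the determinant of the points divides that of the
  images in the valuation ring.\<close>

lemma good_reduction_log_dist_le:
  assumes v: "place v" and good: "good_reduction v d f g" and d: "d > 0"
    and P1: "A \<in> P1" "B \<in> P1" and neq: "ratmap d f g A \<noteq> ratmap d f g B"
  shows "log_dist v A B \<le> log_dist v (ratmap d f g A) (ratmap d f g B)"
proof -
  obtain c where c: "c \<noteq> 0"
      "\<And>i. i \<le> d \<Longrightarrow> in_valring v (coeff (smult c f) i)"
      "\<And>i. i \<le> d \<Longrightarrow> in_valring v (coeff (smult c g) i)"
      "is_valunit v (hres d (smult c f) (smult c g))"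
    using good unfolding good_reduction_def by auto
  define F where "F = smult c f"
  define G where "G = smult c g"
  note cFG = c(2-)[folded F_def G_def]
  define \<Phi> where "\<Phi> X = (hform d F (fst X) (snd X), hform d G (fst X) (snd X))" for X
  have rat: "ratmap d f g X = pnorm (\<Phi> X)" for X
    using ratmap_smult[OF c(1), of d f g] by (simp add: ratmap_def \<Phi>_def F_def G_def fun_eq_iff)
  obtain s where s: "s \<noteq> 0" "primitive_coords v (s * fst A) (s * snd A)"
    using primitive_coords_exist[OF v P1_nonzero] P1 by metis
  obtain t where t: "t \<noteq> 0" "primitive_coords v (t * fst B) (t * snd B)"
    using primitive_coords_exist[OF v P1_nonzero] P1 by metis
  define A' where "A' = (s * fst A, s * snd A)"
  define B' where "B' = (t * fst B, t * snd B)"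
  have prim: "primitive_coords v (fst A') (snd A')" "primitive_coords v (fst B') (snd B')"
    using s t by (auto simp: A'_def B'_def)
  have prim': "primitive_coords v (fst (\<Phi> A')) (snd (\<Phi> A'))" "primitive_coords v (fst (\<Phi> B')) (snd (\<Phi> B'))"
    unfolding \<Phi>_def using primitive_coords_hform[OF v d cFG] prim by auto
  have rA: "ratmap d f g A = pnorm (\<Phi> A')" and rB: "ratmap d f g B = pnorm (\<Phi> B')"
    using pnorm_mult[of "s ^ d"] pnorm_mult[of "t ^ d"] s(1) t(1)
    by (simp_all add: rat \<Phi>_def A'_def B'_def hform_scale)
  have nz: "\<Phi> A' \<noteq> (0, 0)" "\<Phi> B' \<noteq> (0, 0)"
    using prim'[THEN primitive_coords_nonzero] by auto
  have hd': "homdet (\<Phi> A') (\<Phi> B') \<noteq> 0"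
    using pnorm_eq_if_homdet_0[OF nz] neq rA rB by auto
  obtain h where h: "in_valring v h" "homdet (\<Phi> A') (\<Phi> B') = homdet A' B' * h"
    using hform_homdet_dvd[OF v _ _ _ _ cFG(1,2), of "fst A'" "snd A'" "fst B'" "snd B'"] prim
    by (auto simp: \<Phi>_def homdet_def primitive_coords_def)
  have "A \<noteq> B" using neq by auto
  then have hd: "homdet A B \<noteq> 0" using P1 homdet_P1_eq_0_iff by blast
  have "log_dist v A B = log_dist v A' B'"
    unfolding A'_def B'_def using P1
    by (intro log_dist_scale[symmetric] v s t hd) (auto simp: P1_def)
  also have "\<dots> = v (homdet A' B')"
    using prim[THEN primitive_coords_vmin] by (simp add: log_dist_homdet)
  also have "\<dots> \<le> v (homdet (\<Phi> A') (\<Phi> B'))"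
    using h hd' by (auto simp: place_mult[OF v] in_valring_def)
  also have "\<dots> = log_dist v (\<Phi> A') (\<Phi> B')"
    using prim'[THEN primitive_coords_vmin] by (simp add: log_dist_homdet)
  also have "\<dots> = log_dist v (ratmap d f g A) (ratmap d f g B)"
    unfolding rA rB by (rule log_dist_pnorm[OF v nz hd', symmetric])
  finally show ?thesis .
qed

section \<open>Subrings and polynomials over the prime ring\<close>

definition unital_subring :: "'a::comm_ring_1 set \<Rightarrow> bool" where
  "unital_subring A \<longleftrightarrow> 1 \<in> A \<and> (\<forall>a\<in>A. \<forall>b\<in>A. a - b \<in> A \<and> a * b \<in> A)"

definition polys_over :: "'a::comm_ring_1 set \<Rightarrow> 'a poly set" where
  "polys_over A = {q. \<forall>k. coeff q k \<in> A}"

context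
  fixes A :: "'a::comm_ring_1 set"
  assumes A: "unital_subring A"
begin

lemma subring_one: "1 \<in> A"
  and subring_diff: "a \<in> A \<Longrightarrow> b \<in> A \<Longrightarrow> a - b \<in> A"
  and subring_mult: "a \<in> A \<Longrightarrow> b \<in> A \<Longrightarrow> a * b \<in> A"
  using A by (auto simp: unital_subring_def)

lemma subring_zero: "0 \<in> A"
  using subring_diff[OF subring_one subring_one] by simp

lemma subring_minus: "a \<in> A \<Longrightarrow> - a \<in> A"
  using subring_diff[OF subring_zero] by simp

lemma subring_add: "a \<in> A \<Longrightarrow> b \<in> A \<Longrightarrow> a + b \<in> A"
  using subring_diff[of a "- b"] subring_minus by simp

lemma subring_power: "a \<in> A \<Longrightarrow> a ^ k \<in> A"
  by (induction k) (auto intro: subring_one subring_mult)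

lemma subring_sum: "(\<And>i. i \<in> I \<Longrightarrow> h i \<in> A) \<Longrightarrow> (\<Sum>i\<in>I. h i) \<in> A"
  by (induction I rule: infinite_finite_induct) (auto intro: subring_zero subring_add)

lemma subring_of_int: "of_int n \<in> A"
proof -
  have "of_nat k \<in> A" for k
    by (induction k) (auto intro: subring_zero subring_one subring_add)
  then show ?thesis
    by (cases n) (auto simp del: of_nat_Suc intro: subring_minus)
qed

lemma polys_over_0: "0 \<in> polys_over A"
  by (simp add: polys_over_def subring_zero)

lemma polys_over_pCons: "pCons c q \<in> polys_over A \<longleftrightarrow> c \<in> A \<and> q \<in> polys_over A"
  by (force simp: polys_over_def coeff_pCons split: nat.splits)

lemma polys_over_1: "1 \<in> polys_over A"
  by (simp add: one_pCons polys_over_pCons polys_over_0 subring_one)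

lemma polys_over_add: "p \<in> polys_over A \<Longrightarrow> q \<in> polys_over A \<Longrightarrow> p + q \<in> polys_over A"
  and polys_over_diff: "p \<in> polys_over A \<Longrightarrow> q \<in> polys_over A \<Longrightarrow> p - q \<in> polys_over A"
  by (simp_all add: polys_over_def subring_add subring_diff)

lemma polys_over_monom: "c \<in> A \<Longrightarrow> monom c k \<in> polys_over A"
  by (simp add: polys_over_def subring_zero)

lemma polys_over_mult: "p \<in> polys_over A \<Longrightarrow> q \<in> polys_over A \<Longrightarrow> p * q \<in> polys_over A"
  by (auto simp: polys_over_def coeff_mult intro!: subring_sum subring_mult)

lemma polys_over_smult: "c \<in> A \<Longrightarrow> q \<in> polys_over A \<Longrightarrow> smult c q \<in> polys_over A"
  by (simp add: polys_over_def subring_mult)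

lemma polys_over_sum: "(\<And>i. i \<in> I \<Longrightarrow> h i \<in> polys_over A) \<Longrightarrow> (\<Sum>i\<in>I. h i) \<in> polys_over A"
  by (auto simp: polys_over_def coeff_sum intro!: subring_sum)

lemma polys_over_pcompose: "p \<in> polys_over A \<Longrightarrow> q \<in> polys_over A \<Longrightarrow> pcompose p q \<in> polys_over A"
  by (induction p) (auto simp: pcompose_pCons polys_over_pCons polys_over_0
      intro!: polys_over_add polys_over_mult)

lemma poly_in_subring: "q \<in> polys_over A \<Longrightarrow> a \<in> A \<Longrightarrow> poly q a \<in> A"
  by (induction q) (auto simp: polys_over_pCons intro: subring_zero subring_add subring_mult)

end

lemma polys_over_mono: "A \<subseteq> A' \<Longrightarrow> polys_over A \<subseteq> polys_over A'"
  by (auto simp: polys_over_def)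

lemma polys_over_reflect: "0 \<in> A \<Longrightarrow> q \<in> polys_over A \<Longrightarrow> reflect_poly q \<in> polys_over A"
  by (simp add: polys_over_def coeff_reflect_poly)

section \<open>The prime ring and finite spans over it\<close>

abbreviation prime_ring :: "'a::ring_1 set" where
  "prime_ring \<equiv> range of_int"

lemma unital_subring_prime_ring: "unital_subring (prime_ring :: 'a::comm_ring_1 set)"
  unfolding unital_subring_def
  by (auto simp: image_iff simp flip: of_int_diff of_int_mult intro: exI[of _ 1])

lemma prime_ring_subset: "unital_subring A \<Longrightarrow> prime_ring \<subseteq> A"
  using subring_of_int by blast

lemma of_int_mod_CHAR: "(of_int (n mod int CHAR('a)) :: 'a::ring_1) = of_int n"
  by (simp add: of_int_eq_iff_cong_CHAR cong_def)

lemma prime_ring_eq_image: 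
  assumes "CHAR('a::ring_1) > 0"
  shows "(prime_ring :: 'a set) = of_int ` {0..<int CHAR('a)}"
proof -
  have "of_int n \<in> (of_int ` {0..<int CHAR('a)} :: 'a set)" for n
    using assms of_int_mod_CHAR[of n, where 'a = 'a] by (intro image_eqI[of _ _ "n mod int CHAR('a)"]) auto
  then show ?thesis by blast
qed

lemma card_prime_ring:
  assumes "CHAR('a::ring_1) > 0"
  shows "finite (prime_ring :: 'a set)" "card (prime_ring :: 'a set) = CHAR('a)"
proof -
  show "finite (prime_ring :: 'a set)"
    unfolding prime_ring_eq_image[OF assms] by simp
  have "inj_on (of_int :: int \<Rightarrow> 'a) {0..<int CHAR('a)}"
    by (auto simp: inj_on_def of_int_eq_iff_cong_CHAR cong_def)
  then show "card (prime_ring :: 'a set) = CHAR('a)"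
    unfolding prime_ring_eq_image[OF assms] by (simp add: card_image)
qed

lemma inverse_in_prime_ring:
  assumes "prime CHAR('a::field)" "(c :: 'a) \<in> prime_ring"
  shows "inverse c \<in> prime_ring"
proof (cases "c = 0")
  case True
  then show ?thesis by (auto intro: image_eqI[of _ _ 0])
next
  case False
  obtain n where n: "c = of_int n" using assms by blast
  have "\<not> int CHAR('a) dvd n"
    using False by (simp add: n of_int_eq_0_iff_char_dvd)
  then have "coprime n (int CHAR('a))"
    using assms(1) prime_imp_coprime[of "int CHAR('a)" n] by (simp add: coprime_commute)
  then obtain m where "[n * m = 1] (mod int CHAR('a))"
    using cong_solve_coprime_int by blast
  then have "c * of_int m = of_int 1"
    unfolding n of_int_mult[symmetric] of_int_eq_iff_cong_CHAR by simp
  then have "inverse c = of_int m" by (simp add: inverse_unique)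
  then show ?thesis by simp
qed

lemma card_bounded_degree_polys_over:
  assumes "finite A" "A \<noteq> {}"
  shows "finite {q \<in> polys_over A. degree q \<le> T}" (is "finite ?P")
    "card {q \<in> polys_over A. degree q \<le> T} \<le> card A ^ (T + 1)"
proof -
  define h where "h e = (\<Sum>k\<le>T. monom (e k) k)" for e :: "nat \<Rightarrow> 'a"
  have fin: "finite (PiE {..T} (\<lambda>_. A))"
    using assms by (intro finite_PiE) auto
  have "?P \<subseteq> h ` PiE {..T} (\<lambda>_. A)"
  proof
    fix q assume q: "q \<in> ?P"
    have "q = h (restrict (coeff q) {..T})"
      using q poly_as_sum_of_monoms'[of q T] by (simp add: h_def)
    moreover have "restrict (coeff q) {..T} \<in> PiE {..T} (\<lambda>_. A)"
      unfolding restrict_PiE_iff using q by (simp add: polys_over_def)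
    ultimately show "q \<in> h ` PiE {..T} (\<lambda>_. A)"
      by (rule image_eqI)
  qed
  note sub = this
  then show "finite ?P" using fin finite_surj by blast
  have "card ?P \<le> card (PiE {..T} (\<lambda>_. A))"
    using sub fin surj_card_le by blast
  also have "\<dots> = card A ^ (T + 1)"
    by (simp add: card_PiE)
  finally show "card ?P \<le> card A ^ (T + 1)" .
qed

text \<open>A finite truncation of the module generated by \<open>B\<close> over the polynomials in
  \<open>t\<close>: bounding the degrees makes its elements countable for the pigeonhole
  argument.\<close>

definition poly_span :: "'a::field set \<Rightarrow> 'a \<Rightarrow> nat \<Rightarrow> 'a set" where
  "poly_span B t T =
    {\<Sum>b\<in>B. poly (q b) t * b | q. \<forall>b\<in>B. q b \<in> polys_over prime_ring \<and> degree (q b) \<le> T}"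

lemma card_poly_span:
  fixes B :: "'a::field set"
  assumes "CHAR('a) > 0" "finite B"
  shows "finite (poly_span B t T)" "card (poly_span B t T) \<le> CHAR('a) ^ ((T + 1) * card B)"
proof -
  let ?P = "{q \<in> polys_over (prime_ring :: 'a set). degree q \<le> T}"
  define h where "h q = (\<Sum>b\<in>B. poly (q b) t * b)" for q :: "'a \<Rightarrow> 'a poly"
  note P = card_bounded_degree_polys_over[OF card_prime_ring(1)[OF assms(1)], of T]
  have fin: "finite (PiE B (\<lambda>_. ?P))"
    using P assms by (intro finite_PiE) auto
  have sub: "poly_span B t T \<subseteq> h ` PiE B (\<lambda>_. ?P)"
  proof
    fix z assume "z \<in> poly_span B t T"
    then obtain q where q: "z = (\<Sum>b\<in>B. poly (q b) t * b)"
      "\<forall>b\<in>B. q b \<in> polys_over prime_ring \<and> degree (q b) \<le> T"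
      by (auto simp: poly_span_def)
    then have "z = h (restrict q B)" by (simp add: h_def)
    moreover have "restrict q B \<in> PiE B (\<lambda>_. ?P)"
      unfolding restrict_PiE_iff using q by simp
    ultimately show "z \<in> h ` PiE B (\<lambda>_. ?P)"
      by (rule image_eqI)
  qed
  then show "finite (poly_span B t T)" using fin finite_surj by blast
  have "card (poly_span B t T) \<le> card (PiE B (\<lambda>_. ?P))"
    using sub fin surj_card_le by blast
  also have "\<dots> = card ?P ^ card B"
    using assms(2) by (simp add: card_PiE)
  also have "\<dots> \<le> (CHAR('a) ^ (T + 1)) ^ card B"
    using P(2) card_prime_ring(2)[OF assms(1)] by (intro power_mono) auto
  finally show "card (poly_span B t T) \<le> CHAR('a) ^ ((T + 1) * card B)"
    by (simp only: power_mult)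
qed

lemma poly_span_add:
  assumes "x \<in> poly_span B t T" "y \<in> poly_span B t T"
  shows "x + y \<in> poly_span B t T"
proof -
  obtain q r where "x = (\<Sum>b\<in>B. poly (q b) t * b)" "y = (\<Sum>b\<in>B. poly (r b) t * b)"
    "\<forall>b\<in>B. q b \<in> polys_over prime_ring \<and> degree (q b) \<le> T"
    "\<forall>b\<in>B. r b \<in> polys_over prime_ring \<and> degree (r b) \<le> T"
    using assms unfolding poly_span_def by blast
  then show ?thesis
    unfolding poly_span_def
    by (intro CollectI exI[of _ "\<lambda>b. q b + r b"])
       (auto simp: sum.distrib algebra_simps intro: degree_add_le polys_over_add[OF unital_subring_prime_ring])
qed

lemma poly_span_zero: "0 \<in> poly_span B t T"
  unfolding poly_span_def
  by (intro CollectI exI[of _ "\<lambda>_. 0"]) (auto intro: polys_over_0[OF unital_subring_prime_ring])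

lemma poly_span_sum: "(\<And>i. i \<in> I \<Longrightarrow> h i \<in> poly_span B t T) \<Longrightarrow> (\<Sum>i\<in>I. h i) \<in> poly_span B t T"
  by (induction I rule: infinite_finite_induct) (auto intro: poly_span_zero poly_span_add)

lemma poly_span_mult:
  assumes "q \<in> polys_over prime_ring" "degree q \<le> D" "x \<in> poly_span B t T"
  shows "poly q t * x \<in> poly_span B t (T + D)"
proof -
  obtain r where "x = (\<Sum>b\<in>B. poly (r b) t * b)"
    "\<forall>b\<in>B. r b \<in> polys_over prime_ring \<and> degree (r b) \<le> T"
    using assms unfolding poly_span_def by blast
  then show ?thesis
    unfolding poly_span_def using assms(1,2)
    by (intro CollectI exI[of _ "\<lambda>b. q * r b"])
       (force simp: sum_distrib_left algebra_simps intro: order_trans[OF degree_mult_le]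
         polys_over_mult[OF unital_subring_prime_ring])
qed

lemma poly_span_gen:
  assumes "finite B" "b \<in> B"
  shows "b \<in> poly_span B t T"
proof -
  have "b = (\<Sum>b'\<in>B. poly (if b' = b then 1 else 0) t * b')"
    using assms by (subst sum.remove[of _ b]) auto
  then show ?thesis
    unfolding poly_span_def
    by (intro CollectI exI[of _ "\<lambda>b'. if b' = b then 1 else 0"])
       (auto intro: polys_over_0 polys_over_1 unital_subring_prime_ring)
qed

section \<open>Polynomial relations of bounded degree\<close>

lemma polys_over_prime_ring_of_int: "map_poly of_int f \<in> polys_over prime_ring"
  by (simp add: polys_over_def coeff_map_poly)

text \<open>\<open>poly h t\<close> is a common denominator of the coordinates of \<open>z\<close>
  with respect to \<open>B\<close>. A single bound \<open>D\<close> serves for denominator and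
  numerators, so that only one number has to be tracked.\<close>

definition clears :: "'a::field set \<Rightarrow> 'a \<Rightarrow> 'a poly \<Rightarrow> nat \<Rightarrow> 'a \<Rightarrow> bool" where
  "clears B t h D z \<longleftrightarrow> h \<in> polys_over prime_ring \<and> degree h \<le> D \<and> poly h t \<noteq> 0 \<and>
     poly h t * z \<in> poly_span B t D"

lemma clears_mult:
  assumes "clears B t h D z" "g \<in> polys_over prime_ring" "degree g \<le> E" "poly g t \<noteq> 0"
  shows "clears B t (g * h) (D + E) z"
  using assms poly_span_mult[of g E "poly h t * z" B t D]
  by (auto simp: clears_def mult.assoc add.commute intro: polys_over_mult[OF unital_subring_prime_ring]
      order_trans[OF degree_mult_le])

text \<open>Denominators are multiplied together. The properties of \<open>h\<close> are stated
  separately so that they are also available for empty \<open>S\<close>.\<close>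

lemma clears_finite:
  assumes "finite S" and ex: "\<And>z. z \<in> S \<Longrightarrow> \<exists>h D. clears B t h D z"
  shows "\<exists>h D. h \<in> polys_over prime_ring \<and> degree h \<le> D \<and> poly h t \<noteq> 0 \<and> (\<forall>z\<in>S. clears B t h D z)"
  using assms
proof (induction S rule: finite_induct)
  case empty
  show ?case
    by (intro exI[of _ 1] exI[of _ 0]) (auto intro: polys_over_1[OF unital_subring_prime_ring])
next
  case (insert z S)
  obtain h D where h: "h \<in> polys_over prime_ring" "degree h \<le> D" "poly h t \<noteq> 0" "\<forall>z\<in>S. clears B t h D z"
    using insert by (metis insertCI)
  obtain g E where g: "clears B t g E z" using insert by blast
  have "clears B t (g * h) (D + E) z'" if "z' \<in> insert z S" for z'
    using that h g clears_mult[of B t h D z' g E] clears_mult[of B t g E z h D]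
    by (auto simp: clears_def mult.commute add.commute)
  moreover have "g * h \<in> polys_over prime_ring" "degree (g * h) \<le> D + E" "poly (g * h) t \<noteq> 0"
    using calculation by (auto simp: clears_def)
  ultimately show ?case by blast
qed

lemma clears_sum:
  assumes "finite I" and ex: "\<And>i. i \<in> I \<Longrightarrow> \<exists>h D. clears B t h D (z i)"
  shows "\<exists>h D. clears B t h D (\<Sum>i\<in>I. z i)"
proof -
  obtain h D where h: "h \<in> polys_over prime_ring" "degree h \<le> D" "poly h t \<noteq> 0"
    "\<forall>x\<in>z ` I. clears B t h D x"
    using clears_finite[of "z ` I" B t] assms by (metis finite_imageI imageE)
  then have "clears B t h D (\<Sum>i\<in>I. z i)"
    by (auto simp: clears_def sum_distrib_left intro: poly_span_sum)
  then show ?thesis by blast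
qed

lemma spanning_clears:
  fixes B :: "'a::field set"
  assumes B: "finite B"
    and span: "\<And>x::'a. \<exists>c. (\<forall>b\<in>B. c b \<in> rat_subfield t) \<and> x = (\<Sum>b\<in>B. c b * b)"
  shows "\<exists>h D. clears B t h D z"
proof -
  obtain c where c: "\<forall>b\<in>B. c b \<in> rat_subfield t" "z = (\<Sum>b\<in>B. c b * b)"
    using span by blast
  have "\<exists>h D. clears B t h D (c b * b)" if b: "b \<in> B" for b
  proof -
    obtain f g :: "'a poly" where fg: "f \<in> polys_over prime_ring" "g \<in> polys_over prime_ring"
      "poly g t \<noteq> 0" "c b = poly f t / poly g t"
      using c(1) b polys_over_prime_ring_of_int unfolding rat_subfield_def by blast
    let ?D = "max (degree f) (degree g)"
    have "poly f t * b \<in> poly_span B t (0 + ?D)"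
      using fg by (intro poly_span_mult poly_span_gen B b) auto
    then show ?thesis
      using fg by (intro exI[of _ g] exI[of _ ?D]) (auto simp: clears_def)
  qed
  then show ?thesis
    unfolding c(2) by (rule clears_sum[OF B])
qed

text \<open>Each multiplication by \<open>poly h t * x\<close> raises the degree bound by
  \<open>D\<close>. Filling up with \<open>poly h t ^ (L - i)\<close> puts all powers
  \<open>x ^ i\<close> with \<open>i \<le> L\<close> into one and the same span.\<close>

lemma poly_span_mult_power:
  fixes B :: "'a::field set"
  assumes B: "finite B" and h: "h \<in> polys_over prime_ring" "degree h \<le> D"
    and cl: "\<forall>b\<in>B. clears B t h D (x * b)" and z: "z \<in> poly_span B t T" and "i \<le> L"
  shows "poly h t ^ L * x ^ i * z \<in> poly_span B t (T + L * D)"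
proof -
  have step: "poly h t * x * z \<in> poly_span B t (T + D)" if zT: "z \<in> poly_span B t T" for z T
  proof -
    obtain q where q: "z = (\<Sum>b\<in>B. poly (q b) t * b)"
      "\<forall>b\<in>B. q b \<in> polys_over prime_ring \<and> degree (q b) \<le> T"
      using zT by (auto simp: poly_span_def)
    have "poly h t * x * z = (\<Sum>b\<in>B. poly (q b) t * (poly h t * (x * b)))"
      by (simp add: q(1) sum_distrib_left mult_ac)
    also have "\<dots> \<in> poly_span B t (D + T)"
      using q(2) cl by (intro poly_span_sum poly_span_mult) (auto simp: clears_def)
    finally show ?thesis by (simp add: add.commute)
  qed
  have pow: "(poly h t * x) ^ i * z \<in> poly_span B t (T + i * D)" for i
  proof (induction i)
    case 0
    then show ?case using z by simp
  next
    case (Suc i)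
    from step[OF Suc] show ?case by (simp add: mult_ac add_ac)
  qed
  have pow': "poly h t ^ j * y \<in> poly_span B t (T' + j * D)" if "y \<in> poly_span B t T'" for j y T'
  proof (induction j)
    case 0
    then show ?case using that by simp
  next
    case (Suc j)
    from poly_span_mult[OF h Suc] show ?case by (simp add: mult_ac add_ac)
  qed
  have "poly h t ^ (L - i) * ((poly h t * x) ^ i * z) \<in> poly_span B t (T + i * D + (L - i) * D)"
    by (rule pow'[OF pow])
  also have "poly h t ^ (L - i) * ((poly h t * x) ^ i * z) = poly h t ^ (L - i + i) * x ^ i * z"
    unfolding power_add by (simp add: power_mult_distrib)
  also have "T + i * D + (L - i) * D = T + L * D"
    using \<open>i \<le> L\<close> by (simp add: algebra_simps flip: distrib_right)
  finally show ?thesis using \<open>i \<le> L\<close> by simp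
qed

text \<open>For large \<open>L\<close>, with \<open>h\<close>, \<open>g\<close>, \<open>r\<close> clearing denominators, there are more prime-ring combinations of the
  \<open>h^L g^M r x^i y^j\<close> with \<open>i \<le> L\<close> and \<open>j \<le> M\<close> than elements of the finite set they lie in.\<close>
lemma bounded_degree_relation:
  fixes x :: "'a::field"
  assumes gff: "global_function_field TYPE('a)"
  shows "\<exists>M. \<forall>y. \<exists>q. (\<forall>j. q j \<in> polys_over prime_ring) \<and> (\<exists>j\<le>M. q j \<noteq> 0) \<and>
    (\<Sum>j\<le>M. poly (q j) x * y ^ j) = 0"
proof -
  obtain t :: 'a and B :: "'a set" where B: "finite B"
    and span: "\<And>x::'a. \<exists>c. (\<forall>b\<in>B. c b \<in> rat_subfield t) \<and> x = (\<Sum>b\<in>B. c b * b)"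
    using gff unfolding global_function_field_def by blast
  have p: "prime CHAR('a)" using gff by (simp add: global_function_field_def)
  then have p0: "CHAR('a) > 0" and p1: "CHAR('a) > 1" using prime_gt_0_nat prime_gt_1_nat by blast+
  note fin = card_prime_ring[OF p0]
  note sc = spanning_clears[OF B span]
  have mult: "\<exists>h D. h \<in> polys_over prime_ring \<and> degree h \<le> D \<and> poly h t \<noteq> 0 \<and> (\<forall>b\<in>B. clears B t h D (z * b))" for z
    using clears_finite[of "(\<lambda>b. z * b) ` B" B t] B sc by simp
  obtain h D where h: "h \<in> polys_over prime_ring" "degree h \<le> D" "poly h t \<noteq> 0" "\<forall>b\<in>B. clears B t h D (x * b)"
    using mult by blast
  obtain r T where r: "clears B t r T 1" using sc by blast
  define N where "N = card B"
  \<comment> \<open>\<open>D\<close> comes from \<open>x\<close> and \<open>N\<close> from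
    \<open>B\<close>, so \<open>M\<close> is fixed before \<open>y\<close> is chosen; the bound
    \<open>E\<close> for \<open>y\<close> enters only \<open>L\<close>.\<close>
  define M where "M = N * D"
  show ?thesis
  proof (intro exI[of _ M] allI)
    fix y
    obtain g E where g: "g \<in> polys_over prime_ring" "degree g \<le> E" "poly g t \<noteq> 0" "\<forall>b\<in>B. clears B t g E (y * b)"
      using mult by blast
    \<comment> \<open>Chosen so that the span has dimension at most
      \<open>(T + M * E + L * D + 1) * N = L * M + L\<close> over the prime field, which is less
      than the number \<open>(L + 1) * (M + 1)\<close> of monomials.\<close>
    define L where "L = N * (T + M * E + 1)"
    define H where "H = poly h t ^ L * poly g t ^ M * poly r t"
    have H0: "H \<noteq> 0" using h g r by (simp add: H_def clears_def)
    define W where "W = poly_span B t (T + M * E + L * D)"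
    define I where "I = {..L} \<times> {..M}"
    define s where "s c = (\<Sum>k\<in>I. c k * (H * x ^ fst k * y ^ snd k))" for c :: "nat \<times> nat \<Rightarrow> 'a"
    have mem: "H * x ^ i * y ^ j \<in> W" if "i \<le> L" "j \<le> M" for i j
    proof -
      have "poly r t \<in> poly_span B t T" using r by (simp add: clears_def)
      from poly_span_mult_power[OF B h(1,2,4) poly_span_mult_power[OF B g(1,2,4) this that(2)] that(1)]
      show ?thesis by (simp add: H_def W_def mult_ac)
    qed
    have sW: "s c \<in> W" if "c \<in> PiE I (\<lambda>_. prime_ring)" for c
      unfolding s_def W_def
    proof (intro poly_span_sum)
      fix k assume k: "k \<in> I"
      then have "c k \<in> prime_ring" using that by blast
      then have "[:c k:] \<in> polys_over prime_ring"
        by (simp add: polys_over_pCons[OF unital_subring_prime_ring] polys_over_0[OF unital_subring_prime_ring])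
      from poly_span_mult[OF this, of 0, OF _ mem[unfolded W_def, of "fst k" "snd k"]] k
      show "c k * (H * x ^ fst k * y ^ snd k) \<in> poly_span B t (T + M * E + L * D)"
        by (auto simp: I_def)
    qed
    have "\<not> inj_on s (PiE I (\<lambda>_. prime_ring))"
    proof
      assume inj: "inj_on s (PiE I (\<lambda>_. prime_ring))"
      have "CHAR('a) ^ ((L + 1) * (M + 1)) = card (PiE I (\<lambda>_. prime_ring :: 'a set))"
        using fin by (simp add: I_def card_PiE)
      also have "\<dots> \<le> card W"
        using card_poly_span(1)[OF p0 B] sW unfolding W_def by (intro card_inj_on_le[OF inj]) (auto simp: W_def)
      also have "\<dots> \<le> CHAR('a) ^ ((T + M * E + L * D + 1) * N)"
        unfolding W_def N_def by (rule card_poly_span(2)[OF p0 B])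
      finally have "(L + 1) * (M + 1) \<le> (T + M * E + L * D + 1) * N"
        using p1 by (simp only: power_increasing_iff)
      also have "\<dots> = L * M + L"
        by (simp add: L_def M_def algebra_simps)
      finally show False by simp
    qed
    then obtain c c' where c: "c \<in> PiE I (\<lambda>_. prime_ring)" "c' \<in> PiE I (\<lambda>_. prime_ring)"
      "c \<noteq> c'" "s c = s c'"
      unfolding inj_on_def by blast
    \<comment> \<open>The difference of the two colliding combinations, collected by powers of
      \<open>y\<close>. The value \<open>0\<close> beyond \<open>M\<close> ensures that every
      \<open>q j\<close> has coefficients in the prime ring.\<close>
    define q where "q j = (\<Sum>i\<le>L. if j \<le> M then monom (c (i, j) - c' (i, j)) i else 0)" for j
    have q: "q j \<in> polys_over prime_ring" for j
      unfolding q_def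
    proof (intro polys_over_sum[OF unital_subring_prime_ring])
      fix i assume "i \<in> {..L}"
      then have "j \<le> M \<Longrightarrow> c (i, j) - c' (i, j) \<in> prime_ring"
        using c by (intro subring_diff[OF unital_subring_prime_ring]) (auto simp: I_def PiE_iff)
      then show "(if j \<le> M then monom (c (i, j) - c' (i, j)) i else 0) \<in> polys_over prime_ring"
        by (auto intro: polys_over_monom polys_over_0 unital_subring_prime_ring)
    qed
    obtain k where "k \<in> I" "c k \<noteq> c' k"
      using PiE_ext[OF c(1,2)] c(3) by blast
    then obtain i j where ij: "i \<le> L" "j \<le> M" "c (i, j) \<noteq> c' (i, j)"
      by (auto simp: I_def)
    then have "coeff (q j) i \<noteq> 0"
      by (simp add: q_def coeff_sum)
    then have qj: "q j \<noteq> 0" by auto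
    have "0 = s c - s c'" using c(4) by simp
    also have "\<dots> = (\<Sum>k\<in>I. (c k - c' k) * (H * x ^ fst k * y ^ snd k))"
      by (simp add: s_def sum_subtractf algebra_simps)
    also have "\<dots> = H * (\<Sum>k\<in>I. (c k - c' k) * x ^ fst k * y ^ snd k)"
      by (simp add: sum_distrib_left mult_ac)
    also have "(\<Sum>k\<in>I. (c k - c' k) * x ^ fst k * y ^ snd k) =
       (\<Sum>i\<le>L. \<Sum>j\<le>M. (c (i, j) - c' (i, j)) * x ^ i * y ^ j)"
      unfolding I_def by (simp add: sum.cartesian_product split_def)
    also have "\<dots> = (\<Sum>j\<le>M. \<Sum>i\<le>L. (c (i, j) - c' (i, j)) * x ^ i * y ^ j)"
      by (rule sum.swap)
    also have "\<dots> = (\<Sum>j\<le>M. poly (q j) x * y ^ j)"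
      by (intro sum.cong refl) (simp add: q_def poly_sum poly_monom sum_distrib_right)
    finally show "\<exists>q. (\<forall>j. q j \<in> polys_over prime_ring) \<and> (\<exists>j\<le>M. q j \<noteq> 0) \<and>
      (\<Sum>j\<le>M. poly (q j) x * y ^ j) = 0"
      using H0 q qj ij(2) by (intro exI[of _ q]) auto
  qed
qed

section \<open>Valuation subrings\<close>

definition valuation_subring :: "'a::field set \<Rightarrow> bool" where
  "valuation_subring A \<longleftrightarrow> unital_subring A \<and> (\<forall>y. y \<in> A \<or> inverse y \<in> A)"

text \<open>Filters the ring generated by \<open>A\<close> and \<open>y\<close> by degree, which
  allows a descent on the degree needed to express \<open>inverse x\<close>.\<close>

definition bounded_poly_values :: "'a::field set \<Rightarrow> 'a \<Rightarrow> nat \<Rightarrow> 'a set" where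
  "bounded_poly_values A y n = {poly q y | q. q \<in> polys_over A \<and> degree q \<le> n}"

context
  fixes A :: "'a::field set"
  assumes A: "unital_subring A"
begin

lemma bounded_poly_values_add:
  "z \<in> bounded_poly_values A y n \<Longrightarrow> w \<in> bounded_poly_values A y n \<Longrightarrow> z + w \<in> bounded_poly_values A y n"
  unfolding bounded_poly_values_def by (auto simp flip: poly_add intro: degree_add_le polys_over_add[OF A])

lemma bounded_poly_values_mult:
  assumes "a \<in> A" "z \<in> bounded_poly_values A y n"
  shows "a * z \<in> bounded_poly_values A y n"
proof -
  obtain q where "z = poly q y" "q \<in> polys_over A" "degree q \<le> n"
    using assms by (auto simp: bounded_poly_values_def)
  then show ?thesis
    unfolding bounded_poly_values_def using assms(1)
    by (intro CollectI exI[of _ "smult a q"] conjI polys_over_smult[OF A] order_trans[OF degree_smult_le]) auto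
qed

lemma bounded_poly_values_monom:
  assumes "a \<in> A" "i \<le> n"
  shows "a * y ^ i \<in> bounded_poly_values A y n"
  unfolding bounded_poly_values_def using assms
  by (intro CollectI exI[of _ "monom a i"]) (auto simp: poly_monom intro: polys_over_monom[OF A] order_trans[OF degree_monom_le])

lemma bounded_poly_values_sum:
  "(\<And>i. i \<in> I \<Longrightarrow> h i \<in> bounded_poly_values A y n) \<Longrightarrow> (\<Sum>i\<in>I. h i) \<in> bounded_poly_values A y n"
proof (induction I rule: infinite_finite_induct)
  case (insert i I)
  then show ?case by (auto intro: bounded_poly_values_add)
qed (use bounded_poly_values_monom[OF subring_zero[OF A], of 0 n y] in auto)

lemma bounded_poly_values_0: "bounded_poly_values A y 0 = A"
proof -
  have "poly q y \<in> A" if "q \<in> polys_over A" "degree q = 0" for q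
    using that by (auto simp: polys_over_def elim!: degree_eq_zeroE) (metis coeff_pCons_0)
  moreover have "a \<in> bounded_poly_values A y 0" if "a \<in> A" for a
    using bounded_poly_values_monom[OF that, of 0 0 y] by simp
  ultimately show ?thesis by (auto simp: bounded_poly_values_def)
qed

lemma poly_eq_sum_atMost:
  fixes q :: "'a poly"
  assumes "degree q \<le> n"
  shows "poly q y = (\<Sum>i\<le>n. coeff q i * y ^ i)"
  unfolding poly_altdef using assms
  by (intro sum.mono_neutral_left) (auto simp: coeff_eq_0)

text \<open>Multiplying the relation for \<open>inverse x\<close> in \<open>y\<close> by \<open>1 - x b\<close>, where \<open>b\<close> is the constant term of the
  relation in \<open>inverse y\<close>, makes its leading coefficient cancellable.\<close>
lemma bounded_poly_values_reduce:
  assumes x: "x \<in> A" "x \<noteq> 0" and y: "y * y' = 1" and m: "0 < m" "m \<le> n"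
    and n: "inverse x \<in> bounded_poly_values A y n" and m': "inverse x \<in> bounded_poly_values A y' m"
  shows "inverse x \<in> bounded_poly_values A y (n - 1)"
proof -
  obtain p where p: "inverse x = poly p y" "p \<in> polys_over A" "degree p \<le> n"
    using n by (auto simp: bounded_poly_values_def)
  obtain q where q: "inverse x = poly q y'" "q \<in> polys_over A" "degree q \<le> m"
    using m' by (auto simp: bounded_poly_values_def)
  define b where "b = coeff q 0"
  define a where "a = coeff p n"
  have b: "b \<in> A" and a: "a \<in> A" and cq: "coeff q k \<in> A" and cp: "coeff p k \<in> A" for k
    using p q by (auto simp: polys_over_def a_def b_def)
  have y_pow: "y ^ n * y' ^ i = y ^ (n - i)" if "i \<le> n" for i
  proof -
    have "y ^ n * y' ^ i = y ^ (n - i) * (y * y') ^ i"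
      using that by (simp add: power_mult_distrib flip: power_add mult.assoc)
    then show ?thesis by (simp add: y)
  qed
  have "poly q y' = (\<Sum>i\<le>m. coeff q i * y' ^ i)"
    using poly_eq_sum_atMost[OF q(3)] by simp
  also have "\<dots> = b + (\<Sum>i\<in>{1..m}. coeff q i * y' ^ i)"
    by (simp add: b_def atMost_atLeast0 sum.atLeast_Suc_atMost)
  finally have eq_q: "inverse x - b = (\<Sum>i\<in>{1..m}. coeff q i * y' ^ i)"
    using q(1) by simp
  have eq_p: "inverse x = (\<Sum>i\<le>n - 1. coeff p i * y ^ i) + a * y ^ n"
  proof -
    obtain n' where "n = Suc n'" using m by (cases n) auto
    then show ?thesis
      using p(1) poly_eq_sum_atMost[OF p(3), of y] by (simp add: a_def)
  qed
  \<comment> \<open>The relation in \<open>y'\<close> has exponents from \<open>1\<close> to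
    \<open>m \<le> n\<close>, so multiplying it by \<open>y ^ n\<close> leaves only powers of
    \<open>y\<close> below \<open>n\<close>.\<close>
  have "(1 - x * b) * (a * y ^ n) = a * x * (y ^ n * (inverse x - b))"
    using x(2) by (simp add: field_simps)
  also have "\<dots> = a * x * (\<Sum>i\<in>{1..m}. coeff q i * y ^ (n - i))"
    unfolding eq_q using m by (simp add: sum_distrib_left y_pow[symmetric] mult_ac)
  also have "\<dots> \<in> bounded_poly_values A y (n - 1)"
    using a x(1) cq by (intro bounded_poly_values_mult bounded_poly_values_sum bounded_poly_values_monom subring_mult[OF A]) auto
  finally have lead: "(1 - x * b) * (a * y ^ n) \<in> bounded_poly_values A y (n - 1)" .
  have "(1 - x * b) * (\<Sum>i\<le>n - 1. coeff p i * y ^ i) \<in> bounded_poly_values A y (n - 1)"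
    using b x(1) cp
    by (intro bounded_poly_values_mult bounded_poly_values_sum bounded_poly_values_monom subring_mult[OF A] subring_diff[OF A] subring_one[OF A]) auto
  with lead have "(1 - x * b) * inverse x \<in> bounded_poly_values A y (n - 1)"
    by (subst eq_p) (auto simp: ring_distribs intro: bounded_poly_values_add)
  moreover have "b \<in> bounded_poly_values A y (n - 1)"
    using bounded_poly_values_monom[OF b, of 0] by simp
  ultimately have "b + (1 - x * b) * inverse x \<in> bounded_poly_values A y (n - 1)"
    by (rule bounded_poly_values_add[rotated])
  then show ?thesis using x(2) by (simp add: field_simps)
qed

text \<open>The larger of the two degrees can always be lowered. The descent ends at degree
  \<open>0\<close>, where \<open>inverse x\<close> would lie in \<open>A\<close>.\<close>

lemma not_both_bounded_poly_values:
  assumes x: "x \<in> A" "x \<noteq> 0" "inverse x \<notin> A"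
    and "y * y' = 1" "inverse x \<in> bounded_poly_values A y n" "inverse x \<in> bounded_poly_values A y' m"
  shows False
  using assms(4-)
proof (induction "n + m" arbitrary: n m y y' rule: less_induct)
  case less
  have pos: "n > 0" "m > 0"
    using less.prems x(3) bounded_poly_values_0 by (metis gr0I)+
  show ?case
  proof (cases "m \<le> n")
    case True
    have "inverse x \<in> bounded_poly_values A y (n - 1)"
      by (rule bounded_poly_values_reduce[OF x(1,2) less.prems(1) pos(2) True less.prems(2,3)])
    then show False
      using less.hyps[of "n - 1" m y y'] less.prems pos by simp
  next
    case False
    have "inverse x \<in> bounded_poly_values A y' (m - 1)"
      using less.prems pos False
      by (intro bounded_poly_values_reduce[OF x(1,2), of y' y n m]) (auto simp: mult.commute)
    then show False
      using less.hyps[of n "m - 1" y y'] less.prems pos by simp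
  qed
qed

lemma unital_subring_adjoin: "unital_subring {poly q y | q. q \<in> polys_over A}"
  unfolding unital_subring_def
proof (intro conjI ballI)
  show "1 \<in> {poly q y |q. q \<in> polys_over A}"
    using polys_over_1[OF A] by (intro CollectI exI[of _ 1]) simp
  fix a b assume "a \<in> {poly q y |q. q \<in> polys_over A}" "b \<in> {poly q y |q. q \<in> polys_over A}"
  then obtain p q where pq: "a = poly p y" "b = poly q y" "p \<in> polys_over A" "q \<in> polys_over A" by blast
  show "a - b \<in> {poly q y |q. q \<in> polys_over A}"
    using pq by (intro CollectI exI[of _ "p - q"]) (simp add: polys_over_diff[OF A])
  show "a * b \<in> {poly q y |q. q \<in> polys_over A}"
    using pq by (intro CollectI exI[of _ "p * q"]) (simp add: polys_over_mult[OF A])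
qed

end

section \<open>Existence of valuation subrings\<close>

definition algebraic_over_prime_ring :: "'a::field \<Rightarrow> bool" where
  "algebraic_over_prime_ring x \<longleftrightarrow> (\<exists>q. q \<in> polys_over prime_ring \<and> q \<noteq> 0 \<and> poly q x = 0)"

text \<open>Zorn's lemma is applied to the subrings that contain \<open>x\<close> but not its
  inverse. If neither \<open>y\<close> nor its inverse lay in a maximal one, adjoining either would
  produce \<open>inverse x\<close>, contradicting
  \<open>not_both_bounded_poly_values\<close>.\<close>

lemma exists_valuation_subring:
  fixes x :: "'a::field"
  assumes "\<not> algebraic_over_prime_ring x"
  shows "\<exists>A. valuation_subring A \<and> x \<in> A \<and> inverse x \<notin> A"
proof -
  note Z = unital_subring_prime_ring
  have x0: "x \<noteq> 0"
  proof
    assume "x = 0"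
    then have "monom 1 1 \<in> polys_over (prime_ring :: 'a set)" "poly (monom 1 1) x = 0" "monom (1::'a) 1 \<noteq> 0"
      by (auto simp: poly_monom intro!: polys_over_monom[OF Z] subring_one[OF Z])
    with assms show False unfolding algebraic_over_prime_ring_def by blast
  qed
  define \<A> where "\<A> = {A. unital_subring A \<and> x \<in> A \<and> inverse x \<notin> A}"
  define A0 where "A0 = {poly q x | q. q \<in> polys_over (prime_ring :: 'a set)}"
  have "inverse x \<notin> A0"
  proof
    assume "inverse x \<in> A0"
    then obtain q where q: "inverse x = poly q x" "q \<in> polys_over prime_ring" by (auto simp: A0_def)
    \<comment> \<open>The polynomial \<open>X * q - 1\<close> annihilates \<open>x\<close>, and its
      constant term shows that it is nonzero.\<close>
    have "pCons (-1) q \<in> polys_over prime_ring" "poly (pCons (-1) q) x = 0" "pCons (-1) q \<noteq> 0"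
      using x0 q by (auto simp: polys_over_pCons[OF Z] simp flip: q(1) intro!: subring_minus[OF Z] subring_one[OF Z])
    with assms show False unfolding algebraic_over_prime_ring_def by blast
  qed
  moreover have "x \<in> A0"
    unfolding A0_def
    by (intro CollectI exI[of _ "monom 1 1"]) (auto simp: poly_monom intro!: polys_over_monom[OF Z] subring_one[OF Z])
  ultimately have "A0 \<in> \<A>"
    using unital_subring_adjoin[OF Z, of x] by (auto simp: \<A>_def A0_def)
  moreover have "\<Union>\<C> \<in> \<A>" if C: "\<C> \<noteq> {}" "subset.chain \<A> \<C>" for \<C>
  proof -
    have sub: "unital_subring B \<and> x \<in> B \<and> inverse x \<notin> B" if "B \<in> \<C>" for B
      using C that by (auto simp: subset_chain_def \<A>_def)
    have "unital_subring (\<Union>\<C>)"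
      unfolding unital_subring_def
    proof (intro conjI ballI)
      show "1 \<in> \<Union>\<C>" using C(1) sub subring_one by blast
      fix a b assume "a \<in> \<Union>\<C>" "b \<in> \<Union>\<C>"
      then obtain B1 B2 where "B1 \<in> \<C>" "a \<in> B1" "B2 \<in> \<C>" "b \<in> B2" by blast
      moreover from this have "B1 \<subseteq> B2 \<or> B2 \<subseteq> B1"
        using C(2) by (simp add: subset_chain_def)
      ultimately obtain B where B: "B \<in> \<C>" "a \<in> B" "b \<in> B" by blast
      then show "a - b \<in> \<Union>\<C>" "a * b \<in> \<Union>\<C>"
        using sub subring_diff subring_mult by blast+
    qed
    then show ?thesis using sub C(1) by (auto simp: \<A>_def)
  qed
  ultimately have "\<exists>M\<in>\<A>. \<forall>X\<in>\<A>. M \<subseteq> X \<longrightarrow> X = M"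
    by (intro subset_Zorn_nonempty) auto
  then obtain A where A: "A \<in> \<A>" and max: "\<And>X. X \<in> \<A> \<Longrightarrow> A \<subseteq> X \<Longrightarrow> X = A"
    by blast
  have sA: "unital_subring A" and xA: "x \<in> A" "inverse x \<notin> A" using A by (auto simp: \<A>_def)
  have adjoin: "\<exists>n. inverse x \<in> bounded_poly_values A y n" if "y \<notin> A" for y
  proof -
    let ?X = "{poly q y | q. q \<in> polys_over A}"
    have sub: "A \<subseteq> ?X"
    proof
      fix a assume "a \<in> A"
      then show "a \<in> ?X"
        by (intro CollectI exI[of _ "[:a:]"]) (simp add: polys_over_pCons[OF sA] polys_over_0[OF sA])
    qed
    have "y \<in> ?X"
      by (intro CollectI exI[of _ "monom 1 1"]) (auto simp: poly_monom intro!: polys_over_monom[OF sA] subring_one[OF sA])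
    then have "?X \<notin> \<A>" using max[OF _ sub] that by blast
    then have "inverse x \<in> ?X"
      using unital_subring_adjoin[OF sA, of y] sub xA by (auto simp: \<A>_def)
    then show ?thesis by (auto simp: bounded_poly_values_def)
  qed
  have "y \<in> A \<or> inverse y \<in> A" for y
  proof (rule ccontr)
    assume "\<not> (y \<in> A \<or> inverse y \<in> A)"
    then have "y \<notin> A" "inverse y \<notin> A" "y \<noteq> 0" using subring_zero[OF sA] by auto
    then show False
      using adjoin[of y] adjoin[of "inverse y"] not_both_bounded_poly_values[OF sA xA(1) x0 xA(2), of y "inverse y"]
      by auto
  qed
  with sA xA show ?thesis by (auto simp: valuation_subring_def)
qed

section \<open>Units and divisibility in a valuation subring\<close>

definition ring_unit :: "'a::field set \<Rightarrow> 'a \<Rightarrow> bool" where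
  "ring_unit A a \<longleftrightarrow> a \<noteq> 0 \<and> a \<in> A \<and> inverse a \<in> A"

context
  fixes A :: "'a::field set"
  assumes A: "valuation_subring A"
begin

lemma val_sub: "unital_subring A"
  using A by (simp add: valuation_subring_def)

lemma val_total: "y \<in> A \<or> inverse y \<in> A"
  using A by (simp add: valuation_subring_def)

lemma ring_unit_1: "ring_unit A 1"
  by (simp add: ring_unit_def subring_one[OF val_sub])

lemma ring_unit_mult: "ring_unit A a \<Longrightarrow> ring_unit A b \<Longrightarrow> ring_unit A (a * b)"
  by (simp add: ring_unit_def subring_mult[OF val_sub])

lemma ring_unit_inverse: "ring_unit A a \<Longrightarrow> ring_unit A (inverse a)"
  by (simp add: ring_unit_def)

lemma ring_unit_power: "ring_unit A a \<Longrightarrow> ring_unit A (a ^ k)"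
  by (induction k) (auto intro: ring_unit_1 ring_unit_mult)

text \<open>An instance of integral closedness: if \<open>inverse b\<close> is in \<open>A\<close>,
  then so is \<open>b = b ^ k * inverse b ^ (k - 1)\<close>.\<close>

lemma ring_unit_powerD:
  assumes "ring_unit A (a ^ k)" "k > 0"
  shows "ring_unit A a"
proof -
  have *: "b \<in> A" if b: "ring_unit A (b ^ k)" for b
  proof (cases "b \<in> A")
    case False
    then have "inverse b \<in> A" using val_total by blast
    then have "b ^ k * inverse b ^ (k - 1) \<in> A"
      using b by (intro subring_mult[OF val_sub] subring_power[OF val_sub, of "inverse b"]) (auto simp: ring_unit_def)
    moreover obtain j where "k = Suc j" using assms(2) by (cases k) auto
    then have "b ^ k * inverse b ^ (k - 1) = b"
      using b by (simp add: ring_unit_def power_inverse)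
    ultimately show ?thesis by simp
  qed
  have "ring_unit A (inverse a ^ k)"
    using ring_unit_inverse[OF assms(1)] by (simp add: power_inverse)
  with *[of a] *[of "inverse a"] assms show ?thesis by (auto simp: ring_unit_def)
qed

text \<open>A valuation ring is local: of two nonzero elements one divides the other, and if
  \<open>d\<close> divides \<open>c\<close> and \<open>c + d\<close> is a unit, then
  \<open>d\<close> is a unit.\<close>

lemma nonunits_add:
  assumes "a \<in> A" "b \<in> A" "\<not> ring_unit A a" "\<not> ring_unit A b"
  shows "\<not> ring_unit A (a + b)"
proof
  assume u: "ring_unit A (a + b)"
  have *: False if "c / d \<in> A" "d \<noteq> 0" "\<not> ring_unit A d" "d \<in> A" "ring_unit A (c + d)" for c d
  proof -
    have "(c / d + 1) * inverse (c + d) \<in> A"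
      using that by (intro subring_mult[OF val_sub] subring_add[OF val_sub] subring_one[OF val_sub]) (auto simp: ring_unit_def)
    also have "(c / d + 1) * inverse (c + d) = inverse d"
      using that by (auto simp: ring_unit_def field_simps)
    finally show False using that by (simp add: ring_unit_def)
  qed
  show False
  proof (cases "a = 0 \<or> b = 0")
    case True
    then show ?thesis using u assms by auto
  next
    case False
    have "a / b \<in> A \<or> b / a \<in> A"
      using val_total[of "a / b"] by simp
    then show ?thesis
      using *[of a b] *[of b a] u False assms by (auto simp: add.commute)
  qed
qed

lemma nonunits_sum:
  assumes "\<And>i. i \<in> I \<Longrightarrow> h i \<in> A \<and> \<not> ring_unit A (h i)"
  shows "(\<Sum>i\<in>I. h i) \<in> A \<and> \<not> ring_unit A (\<Sum>i\<in>I. h i)"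
  using assms
proof (induction I rule: infinite_finite_induct)
  case (insert i I)
  then show ?case using nonunits_add subring_add[OF val_sub] by simp
qed (auto simp: ring_unit_def subring_zero[OF val_sub])

text \<open>In a vanishing sum, the summands of minimal valuation cannot be alone.\<close>
lemma vanishing_sum_two_associates:
  assumes fin: "finite I" and sum: "(\<Sum>i\<in>I. z i) = 0" and nz: "\<exists>i\<in>I. z i \<noteq> 0"
  shows "\<exists>i\<in>I. \<exists>j\<in>I. i \<noteq> j \<and> z i \<noteq> 0 \<and> z j \<noteq> 0 \<and> ring_unit A (z i / z j)"
proof (rule ccontr)
  assume contr: "\<not> ?thesis"
  \<comment> \<open>Divisibility is total in a valuation ring, so a finite family has a member
    dividing all others.\<close>
  have minim: "\<exists>m\<in>J. \<forall>i\<in>J. z i / z m \<in> A" if "finite J" "J \<noteq> {}" "\<forall>i\<in>J. z i \<noteq> 0" for J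
    using that
  proof (induction J rule: finite_ne_induct)
    case (singleton i)
    then show ?case using subring_one[OF val_sub] by simp
  next
    case (insert i J)
    then obtain m where m: "m \<in> J" "\<forall>i\<in>J. z i / z m \<in> A" by auto
    show ?case
    proof (cases "z i / z m \<in> A")
      case True
      then show ?thesis using m by auto
    next
      case False
      then have im: "z m / z i \<in> A" using val_total[of "z i / z m"] by simp
      have "z k / z i \<in> A" if "k \<in> J" for k
      proof -
        have "z k / z m * (z m / z i) \<in> A"
          using m that im by (intro subring_mult[OF val_sub]) auto
        then show ?thesis using insert.prems m(1) by simp
      qed
      then show ?thesis using insert.prems subring_one[OF val_sub] by (intro bexI[of _ i]) auto
    qed
  qed
  define J where "J = {i \<in> I. z i \<noteq> 0}"
  have "finite J" "J \<noteq> {}" "\<forall>i\<in>J. z i \<noteq> 0"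
    using fin nz by (auto simp: J_def)
  from minim[OF this] obtain m where m: "m \<in> J" "\<forall>i\<in>J. z i / z m \<in> A"
    by blast
  \<comment> \<open>After division by \<open>z m\<close> the other summands are nonunits by the
    assumption \<open>contr\<close>, yet they add up to the unit \<open>-1\<close>.\<close>
  have "(\<Sum>i\<in>J - {m}. z i / z m) \<in> A \<and> \<not> ring_unit A (\<Sum>i\<in>J - {m}. z i / z m)"
    using m contr by (intro nonunits_sum) (auto simp: J_def)
  moreover have "(\<Sum>i\<in>J. z i) = 0"
    using sum fin unfolding J_def by (subst sum.mono_neutral_left[of I]) auto
  then have "z m + (\<Sum>i\<in>J - {m}. z i) = 0"
    using sum.remove[of J m z] m(1) fin by (simp add: J_def)
  then have "(\<Sum>i\<in>J - {m}. z i) / z m = -1"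
    using m(1) by (simp add: J_def field_simps eq_neg_iff_add_eq_0 add.commute)
  then have "(\<Sum>i\<in>J - {m}. z i / z m) = -1"
    by (simp add: sum_divide_distrib)
  ultimately show False
    using subring_minus[OF val_sub subring_one[OF val_sub]] by (simp add: ring_unit_def)
qed

lemma prime_ring_ring_unit:
  assumes "prime CHAR('a)" "c \<in> prime_ring" "c \<noteq> 0"
  shows "ring_unit A c"
  using inverse_in_prime_ring[OF assms(1,2)] prime_ring_subset[OF val_sub] assms
  by (auto simp: ring_unit_def)

end

section \<open>Places of a global function field\<close>

text \<open>The values form a nonzero subgroup of the integers; dividing by its positive generator
  makes the valuation surjective.\<close>

lemma place_of_integer_valuation:
  fixes \<kappa> :: "'a::field \<Rightarrow> int"
  assumes mult: "\<And>x y. x \<noteq> 0 \<Longrightarrow> y \<noteq> 0 \<Longrightarrow> \<kappa> (x * y) = \<kappa> x + \<kappa> y"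
    and add: "\<And>x y. x \<noteq> 0 \<Longrightarrow> y \<noteq> 0 \<Longrightarrow> x + y \<noteq> 0 \<Longrightarrow> min (\<kappa> x) (\<kappa> y) \<le> \<kappa> (x + y)"
    and x: "x \<noteq> 0" "\<kappa> x > 0"
  obtains v e where "place v" "e > 0" "\<And>y. y \<noteq> 0 \<Longrightarrow> \<kappa> y = e * v y"
proof -
  have one: "\<kappa> 1 = 0" using mult[of 1 1] by simp
  have pow: "\<kappa> (y ^ n) = int n * \<kappa> y" if "y \<noteq> 0" for y n
    by (induction n) (auto simp: one mult that algebra_simps)
  have inv: "\<kappa> (inverse y) = - \<kappa> y" if "y \<noteq> 0" for y
    using mult[of y "inverse y"] that one by simp
  have powi: "\<kappa> (y powi n) = n * \<kappa> y" if "y \<noteq> 0" for y n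
    using that by (cases "n \<ge> 0") (auto simp: power_int_def pow inv)
  define P where "P n \<longleftrightarrow> n > 0 \<and> (\<exists>y. y \<noteq> 0 \<and> \<kappa> y = int n)" for n
  define e where "e = (LEAST n. P n)"
  have "P (nat (\<kappa> x))" using x by (auto simp: P_def)
  then have "P e" unfolding e_def by (rule LeastI)
  then obtain y0 where e: "e > 0" and y0: "y0 \<noteq> 0" "\<kappa> y0 = int e" by (auto simp: P_def)
  have dvd: "int e dvd \<kappa> y" if "y \<noteq> 0" for y
  proof (rule ccontr)
    define r where "r = \<kappa> y mod int e"
    assume "\<not> int e dvd \<kappa> y"
    then have "r \<noteq> 0" by (simp add: r_def dvd_eq_mod_eq_0)
    moreover have "0 \<le> r" "r < int e"
      using e by (simp_all add: r_def)
    ultimately have r: "0 < r" "r < int e" by linarith+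
    \<comment> \<open>The remainder is itself a value, contradicting the minimality of
      \<open>e\<close> unless it vanishes.\<close>
    have "\<kappa> (y * y0 powi (- (\<kappa> y div int e))) = r"
      using that y0 by (simp add: mult powi r_def minus_div_mult_eq_mod)
    then have "P (nat r)"
      using r that y0 by (auto simp: P_def intro!: exI[of _ "y * y0 powi (- (\<kappa> y div int e))"])
    then have "e \<le> nat r" unfolding e_def by (rule Least_le)
    with r show False by simp
  qed
  define v where "v y = (if y = 0 then 0 else \<kappa> y div int e)" for y
  have v: "\<kappa> y = int e * v y" if "y \<noteq> 0" for y
    using dvd[OF that] that by (simp add: v_def)
  have "place v"
    unfolding place_def
  proof (intro conjI allI impI)
    show "v 0 = 0" by (simp add: v_def)
    fix x y :: 'a assume nz: "x \<noteq> 0" "y \<noteq> 0"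
    show "v (x * y) = v x + v y"
      using mult[OF nz] v[of x] v[of y] v[of "x * y"] nz e by (simp flip: distrib_left)
    assume nz': "x + y \<noteq> 0"
    have "min (int e * v x) (int e * v y) \<le> int e * v (x + y)"
      using add[OF nz nz'] v nz nz' by simp
    then show "min (v x) (v y) \<le> v (x + y)"
      using e by (auto simp: min_def split: if_splits)
  next
    fix n
    have "int e * v (y0 powi n) = n * int e"
      using v[of "y0 powi n"] y0 by (auto simp: powi)
    then have "v (y0 powi n) = n"
      using e by (metis mult.commute mult_cancel_left of_nat_0_less_iff order_less_irrefl)
    then show "\<exists>x. x \<noteq> 0 \<and> v x = n"
      using y0 by (intro exI[of _ "y0 powi n"]) auto
  qed
  with v e that[of v "int e"] show ?thesis by simp
qed

text \<open>A fixed power \<open>y ^ F\<close> of every nonzero \<open>y\<close> is a power of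
  \<open>x\<close> times a unit of the valuation subring. The exponent \<open>\<kappa> y\<close> is
  an integer valuation with \<open>\<kappa> x = F > 0\<close>, and normalizing it gives the
  place.\<close>

lemma exists_place_pos:
  fixes x :: "'a::field"
  assumes gff: "global_function_field TYPE('a)" and x: "\<not> algebraic_over_prime_ring x"
  shows "\<exists>v. place v \<and> v x > 0"
proof -
  obtain A where A: "valuation_subring A" and xA: "x \<in> A" "inverse x \<notin> A"
    using exists_valuation_subring[OF x] by blast
  note S = val_sub[OF A]
  have p: "prime CHAR('a)" using gff by (simp add: global_function_field_def)
  have x0: "x \<noteq> 0" using xA subring_zero[OF S] by auto
  have x_nonunit: "\<not> ring_unit A x" using xA by (simp add: ring_unit_def)
  have x_mult_nonunit: "\<not> ring_unit A (x * r)" if r: "r \<in> A" for r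
  proof
    assume u: "ring_unit A (x * r)"
    then have "r * inverse (x * r) \<in> A"
      using r by (intro subring_mult[OF S]) (auto simp: ring_unit_def)
    also have "r * inverse (x * r) = inverse x"
      using u by (auto simp: ring_unit_def field_simps)
    finally show False using xA by simp
  qed
  \<comment> \<open>This makes exponents of \<open>x\<close> unique, and hence
    \<open>\<kappa>\<close> independent of the choice made in its definition.\<close>
  have powi_unit: "k = 0" if "ring_unit A (x powi k)" for k
  proof (rule ccontr)
    assume "k \<noteq> 0"
    have "ring_unit A (x ^ nat \<bar>k\<bar>)"
      using that ring_unit_inverse[OF A, of "inverse x ^ nat (- k)"]
      by (auto simp: power_int_def power_inverse split: if_splits)
    then show False
      using ring_unit_powerD[OF A] \<open>k \<noteq> 0\<close> x_nonunit by auto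
  qed
  \<comment> \<open>Here \<open>k\<close> is the order of vanishing of \<open>q\<close> at
    \<open>0\<close>: the lowest nonzero coefficient is a unit of \<open>A\<close>, and the higher
    terms add a multiple of the nonunit \<open>x\<close>.\<close>
  have poly_assoc: "\<exists>k::nat. ring_unit A (poly q x / x ^ k)" if "q \<in> polys_over prime_ring" "q \<noteq> 0" for q
    using that
  proof (induction q)
    case 0
    then show ?case by simp
  next
    case (pCons c q)
    have c: "c \<in> prime_ring" and q: "q \<in> polys_over prime_ring"
      using pCons.prems by (auto simp: polys_over_pCons[OF unital_subring_prime_ring])
    show ?case
    proof (cases "c = 0")
      case True
      then obtain k where "ring_unit A (poly q x / x ^ k)" using pCons q by auto
      then show ?thesis using True x0 by (intro exI[of _ "Suc k"]) simp
    next
      case False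
      then have cu: "ring_unit A c" using prime_ring_ring_unit[OF A p c] by simp
      have qA: "poly q x \<in> A"
        using q polys_over_mono[OF prime_ring_subset[OF S]] by (intro poly_in_subring[OF S _ xA(1)]) blast
      have n: "x * - poly q x \<in> A" "\<not> ring_unit A (x * - poly q x)"
        using qA xA by (auto intro!: subring_mult[OF S] subring_minus[OF S] x_mult_nonunit simp del: mult_minus_right)
      have "c + x * poly q x \<in> A"
        using cu qA xA by (intro subring_add[OF S] subring_mult[OF S]) (auto simp: ring_unit_def)
      then have "ring_unit A (c + x * poly q x)"
        using nonunits_add[OF A _ n(1) _ n(2), of "c + x * poly q x"] cu by auto
      then show ?thesis by (intro exI[of _ 0]) simp
    qed
  qed
  obtain M where M: "\<And>y. \<exists>q. (\<forall>j. q j \<in> polys_over prime_ring) \<and> (\<exists>j\<le>M. q j \<noteq> 0) \<and>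
      (\<Sum>j\<le>M. poly (q j) x * y ^ j) = 0"
    using bounded_degree_relation[OF gff, of x] by blast
  \<comment> \<open>Two terms of the relation for \<open>y\<close> are associates. Their
    coefficients are powers of \<open>x\<close> up to units, so their quotient turns
    \<open>y ^ (i - j)\<close> into such a power as well.\<close>
  have power_assoc: "\<exists>r k. 1 \<le> r \<and> r \<le> M \<and> ring_unit A (y ^ r * x powi k)" if y: "y \<noteq> 0" for y
  proof -
    from M[of y] obtain q where q: "\<forall>j. q j \<in> polys_over prime_ring" "\<exists>j\<le>M. q j \<noteq> 0"
      "(\<Sum>j\<le>M. poly (q j) x * y ^ j) = 0"
      by (elim exE conjE) blast
    define z where "z j = poly (q j) x * y ^ j" for j
    have z_nz: "z j \<noteq> 0 \<longleftrightarrow> q j \<noteq> 0" for j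
      using x y q(1) by (auto simp: z_def algebraic_over_prime_ring_def)
    have "\<exists>i\<in>{..M}. \<exists>j\<in>{..M}. i \<noteq> j \<and> z i \<noteq> 0 \<and> z j \<noteq> 0 \<and> ring_unit A (z i / z j)"
      using q(2,3) z_nz by (intro vanishing_sum_two_associates[OF A]) (auto simp: z_def)
    then obtain i j where ij: "i \<le> M" "j \<le> M" "i \<noteq> j" "z i \<noteq> 0" "z j \<noteq> 0" "ring_unit A (z i / z j)"
      by auto
    have main: "\<exists>r k. 1 \<le> r \<and> r \<le> M \<and> ring_unit A (y ^ r * x powi k)"
      if l: "j < i" "i \<le> M" "z i \<noteq> 0" "z j \<noteq> 0" "ring_unit A (z i / z j)" for i j
    proof -
      obtain a b where ab: "ring_unit A (poly (q i) x / x ^ a)" "ring_unit A (poly (q j) x / x ^ b)"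
        using poly_assoc q(1) z_nz l by metis
      let ?u = "poly (q i) x / x ^ a" and ?w = "poly (q j) x / x ^ b"
      have nz: "poly (q i) x \<noteq> 0" "poly (q j) x \<noteq> 0" using l by (auto simp: z_def)
      have "ring_unit A (z i / z j * inverse ?u * ?w)"
        by (intro ring_unit_mult[OF A] ring_unit_inverse[OF A] l ab)
      also have "z i / z j * inverse ?u * ?w = y ^ (i - j) * x powi (int a - int b)"
        using nz x0 y l by (simp add: z_def power_diff power_int_diff field_simps)
      finally show ?thesis using l by (intro exI[of _ "i - j"] exI[of _ "int a - int b"]) auto
    qed
    show ?thesis
    proof (cases "j < i")
      case True
      then show ?thesis using main ij by blast
    next
      case False
      then show ?thesis
        using main[of i j] ij ring_unit_inverse[OF A ij(6)] by simp
    qed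
  qed
  \<comment> \<open>The exponent \<open>r \<le> M\<close> depends on \<open>y\<close>; the factorial
    is a common multiple of all of them.\<close>
  define F :: nat where "F = fact M"
  have F0: "F > 0" by (simp add: F_def)
  have ex: "\<exists>k. ring_unit A (y ^ F * x powi (- k))" if y: "y \<noteq> 0" for y
  proof -
    obtain r k where r: "1 \<le> r" "r \<le> M" "ring_unit A (y ^ r * x powi k)"
      using power_assoc[OF y] by blast
    then have "r dvd F" unfolding F_def by (intro dvd_fact) auto
    then obtain s where s: "F = r * s" by blast
    have "ring_unit A ((y ^ r * x powi k) ^ s)"
      by (rule ring_unit_power[OF A r(3)])
    also have "(y ^ r * x powi k) ^ s = y ^ F * x powi (- (- k * int s))"
      by (simp add: s power_mult_distrib power_mult power_int_mult)
    finally show ?thesis by blast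
  qed
  define \<kappa> where "\<kappa> y = (SOME k. ring_unit A (y ^ F * x powi (- k)))" for y
  have \<kappa>: "ring_unit A (y ^ F * x powi (- \<kappa> y))" if "y \<noteq> 0" for y
    unfolding \<kappa>_def by (rule someI_ex[OF ex[OF that]])
  have \<kappa>_eq: "\<kappa> y = k" if y: "y \<noteq> 0" and u: "ring_unit A (y ^ F * x powi (- k))" for y k
  proof -
    have "ring_unit A (y ^ F * x powi (- \<kappa> y) * inverse (y ^ F * x powi (- k)))"
      by (intro ring_unit_mult[OF A] ring_unit_inverse[OF A] \<kappa> y u)
    also have "y ^ F * x powi (- \<kappa> y) * inverse (y ^ F * x powi (- k)) = x powi (k - \<kappa> y)"
      using y x0 by (simp add: power_int_diff power_int_minus field_simps)
    finally show ?thesis using powi_unit by force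
  qed
  have mult: "\<kappa> (y * z) = \<kappa> y + \<kappa> z" if "y \<noteq> 0" "z \<noteq> 0" for y z
  proof (rule \<kappa>_eq)
    have "ring_unit A (y ^ F * x powi (- \<kappa> y) * (z ^ F * x powi (- \<kappa> z)))"
      by (intro ring_unit_mult[OF A] \<kappa> that)
    also have "y ^ F * x powi (- \<kappa> y) * (z ^ F * x powi (- \<kappa> z)) = (y * z) ^ F * x powi (- (\<kappa> y + \<kappa> z))"
      using power_int_add[of x "- \<kappa> y" "- \<kappa> z"] x0 by (simp add: power_mult_distrib)
    finally show "ring_unit A ((y * z) ^ F * x powi (- (\<kappa> y + \<kappa> z)))" .
  qed (use that in simp)
  have \<kappa>_x: "\<kappa> x = int F"
    using x0 ring_unit_1[OF A] by (intro \<kappa>_eq) (auto simp: power_int_minus)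
  \<comment> \<open>Membership in \<open>A\<close> is read off from \<open>\<kappa>\<close>, which
    reduces the ultrametric inequality to closure of \<open>A\<close> under addition.\<close>
  have nonneg: "y \<in> A \<longleftrightarrow> 0 \<le> \<kappa> y" if y: "y \<noteq> 0" for y
  proof
    assume pos: "0 \<le> \<kappa> y"
    show "y \<in> A"
    proof (rule ccontr)
      assume "y \<notin> A"
      then have "inverse y \<in> A" using val_total[OF A] by blast
      then have inv: "inverse (y ^ F) \<in> A" using subring_power[OF S, of "inverse y" F] by (simp add: power_inverse)
      have "y ^ F * x powi (- \<kappa> y) * x ^ nat (\<kappa> y) \<in> A"
        using \<kappa>[OF y] by (intro subring_mult[OF S _ subring_power[OF S xA(1)]]) (simp add: ring_unit_def)
      moreover obtain k where "\<kappa> y = int k" using pos by (metis nonneg_int_cases)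
      ultimately have "y ^ F \<in> A"
        using x0 by (simp add: power_int_minus mult.assoc)
      then have "ring_unit A (y ^ F)" using y inv by (simp add: ring_unit_def)
      from ring_unit_powerD[OF A this F0] show False using \<open>y \<notin> A\<close> by (simp add: ring_unit_def)
    qed
  next
    assume yA: "y \<in> A"
    show "0 \<le> \<kappa> y"
    proof (rule ccontr)
      assume "\<not> 0 \<le> \<kappa> y"
      then obtain j where j: "nat (- \<kappa> y) = Suc j" by (cases "nat (- \<kappa> y)") auto
      then have eq: "y ^ F * x powi (- \<kappa> y) = x * (y ^ F * x ^ j)"
        using \<open>\<not> 0 \<le> \<kappa> y\<close> by (simp add: power_int_def)
      have "y ^ F * x ^ j \<in> A"
        by (intro subring_mult[OF S] subring_power[OF S] yA xA(1))
      from x_mult_nonunit[OF this] \<kappa>[OF y] show False unfolding eq by simp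
    qed
  qed
  have add1: "\<kappa> z \<le> \<kappa> (y + z)" if nz: "y \<noteq> 0" "z \<noteq> 0" "y + z \<noteq> 0" and le: "\<kappa> z \<le> \<kappa> y" for y z
  proof -
    have "\<kappa> y = \<kappa> (y / z) + \<kappa> z" "\<kappa> (y + z) = \<kappa> ((y + z) / z) + \<kappa> z"
      using mult[of "y / z" z] mult[of "(y + z) / z" z] nz by auto
    moreover from this have "y / z \<in> A" using nonneg[of "y / z"] nz le by simp
    then have "y / z + 1 \<in> A" by (intro subring_add[OF S] subring_one[OF S])
    then have "(y + z) / z \<in> A" using nz by (simp add: add_divide_distrib)
    then have "0 \<le> \<kappa> ((y + z) / z)" using nonneg[of "(y + z) / z"] nz by simp
    ultimately show ?thesis by simp
  qed
  have add: "min (\<kappa> y) (\<kappa> z) \<le> \<kappa> (y + z)" if "y \<noteq> 0" "z \<noteq> 0" "y + z \<noteq> 0" for y z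
    using add1[of y z] add1[of z y] that by (cases "\<kappa> z \<le> \<kappa> y") (auto simp: add.commute)
  obtain v e where "place v" "e > 0" "\<And>y. y \<noteq> 0 \<Longrightarrow> \<kappa> y = e * v y"
    using place_of_integer_valuation[of \<kappa> x, OF mult add x0] \<kappa>_x F0 by auto
  then show ?thesis
    using \<kappa>_x F0 x0 by (metis of_nat_0_less_iff zero_less_mult_pos)
qed

section \<open>Algebraic elements and their values at places\<close>

lemma algebraic_inverse:
  assumes "algebraic_over_prime_ring (inverse x)"
  shows "algebraic_over_prime_ring x"
proof (cases "x = 0")
  case False
  obtain q where "q \<in> polys_over prime_ring" "q \<noteq> 0" "poly q (inverse x) = 0"
    using assms by (auto simp: algebraic_over_prime_ring_def)
  then show ?thesis
    using False polys_over_reflect[OF subring_zero[OF unital_subring_prime_ring], of q]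
    by (auto simp: algebraic_over_prime_ring_def poly_reflect_poly_nz intro!: exI[of _ "reflect_poly q"])
qed (use assms in simp)

lemma algebraic_add_1:
  fixes x :: "'a::field"
  assumes "algebraic_over_prime_ring x"
  shows "algebraic_over_prime_ring (1 + x)"
proof -
  note Z = unital_subring_prime_ring
  obtain q where q: "q \<in> polys_over prime_ring" "q \<noteq> 0" "poly q x = 0"
    using assms by (auto simp: algebraic_over_prime_ring_def)
  have "[:-1, 1:] \<in> polys_over (prime_ring :: 'a set)"
    by (auto simp: polys_over_pCons[OF Z] polys_over_0[OF Z] intro: subring_minus[OF Z] subring_one[OF Z])
  then have "pcompose q [:-1, 1:] \<in> polys_over prime_ring"
    using q by (intro polys_over_pcompose[OF Z])
  moreover have "pcompose q [:-1, 1:] \<noteq> 0"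
    using q(2) pcompose_eq_0[of q "[:-1, 1:]"] by auto
  ultimately show ?thesis
    using q(3) unfolding algebraic_over_prime_ring_def
    by (intro exI[of _ "pcompose q [:-1, 1:]"]) (auto simp: poly_pcompose)
qed

text \<open>The nonzero terms of an annihilating polynomial have valuations \<open>i * v x\<close>,
  as its nonzero coefficients are units. Two terms of different degree must share their valuation,
  which forces \<open>v x = 0\<close>.\<close>

lemma place_algebraic_eq_0:
  fixes x :: "'a::field"
  assumes p: "prime CHAR('a)" and v: "place v" and "algebraic_over_prime_ring x" and x0: "x \<noteq> 0"
  shows "v x = 0"
proof -
  define A where "A = {a. in_valring v a}"
  have "unital_subring A"
    by (auto simp: unital_subring_def A_def in_valring_one[OF v] intro: in_valring_diff[OF v] in_valring_mult[OF v])
  moreover have "y \<in> A \<or> inverse y \<in> A" for y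
    using place_inverse[OF v, of y] by (auto simp: A_def in_valring_def)
  ultimately have A: "valuation_subring A" by (simp add: valuation_subring_def)
  have unit: "ring_unit A a \<longleftrightarrow> a \<noteq> 0 \<and> v a = 0" for a
    using place_inverse[OF v, of a] by (auto simp: ring_unit_def A_def in_valring_def)
  obtain q where q: "q \<in> polys_over prime_ring" "q \<noteq> 0" "poly q x = 0"
    using assms by (auto simp: algebraic_over_prime_ring_def)
  define z where "z i = coeff q i * x ^ i" for i
  have "\<exists>i\<in>{..degree q}. \<exists>j\<in>{..degree q}. i \<noteq> j \<and> z i \<noteq> 0 \<and> z j \<noteq> 0 \<and> ring_unit A (z i / z j)"
    using q x0 by (intro vanishing_sum_two_associates[OF A]) (auto simp: z_def poly_altdef intro: bexI[of _ "degree q"])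
  then obtain i j where ij: "i \<noteq> j" "z i \<noteq> 0" "z j \<noteq> 0" "ring_unit A (z i / z j)" by blast
  have "v (z k) = int k * v x" if "z k \<noteq> 0" for k
  proof -
    have "coeff q k \<in> prime_ring" "coeff q k \<noteq> 0"
      using q(1) that by (auto simp: polys_over_def z_def)
    then have "v (coeff q k) = 0"
      using prime_ring_ring_unit[OF A p] unit by blast
    then show ?thesis
      using \<open>coeff q k \<noteq> 0\<close> x0 by (simp add: z_def place_mult[OF v] place_power[OF v])
  qed
  then have "int i * v x = int j * v x"
    using ij unit by (simp add: place_divide[OF v])
  then show ?thesis using ij(1) by simp
qed

text \<open>A transcendental \<open>x\<close> would have a zero and a pole, which are different
  places and cannot both be \<open>v0\<close>. So \<open>x\<close> is algebraic, and then so is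
  \<open>1 + x\<close>.\<close>

lemma place_unit_outside_one_place:
  fixes x :: "'a::field"
  assumes gff: "global_function_field TYPE('a)"
    and x: "x \<noteq> 0" "1 + x \<noteq> 0"
    and outside: "\<And>v. place v \<Longrightarrow> v \<noteq> v0 \<Longrightarrow> v x = 0"
    and v: "place v"
  shows "v (1 + x) = 0"
proof -
  have p: "prime CHAR('a)" using gff by (simp add: global_function_field_def)
  have "algebraic_over_prime_ring x"
  proof (rule ccontr)
    assume tr: "\<not> algebraic_over_prime_ring x"
    obtain u where u: "place u" "u x > 0" using exists_place_pos[OF gff tr] by blast
    obtain w where w: "place w" "w (inverse x) > 0"
      using exists_place_pos[OF gff, of "inverse x"] tr algebraic_inverse by blast
    have "w x < 0" using w place_inverse[OF w(1) x(1)] by simp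
    then show False using u w(1) outside by (metis less_irrefl less_asym)
  qed
  then show ?thesis
    by (intro place_algebraic_eq_0 p v algebraic_add_1 x)
qed

section \<open>Cycles of rational maps\<close>

text \<open>The Pluecker relation is divided by one of its products, giving \<open>x\<close> and
  \<open>1 + x\<close> as negated quotients of products. Each point occurs once in each product, so
  the \<open>vmin\<close> terms cancel and valuations of quotients are differences of distance
  sums.\<close>

lemma homdet_cross:
  assumes gff: "global_function_field TYPE('a::field)"
    and P1: "A \<in> P1" "B \<in> P1" "C \<in> P1" "D \<in> P1"
    and neq: "A \<noteq> B" "A \<noteq> C" "A \<noteq> D" "B \<noteq> C" "B \<noteq> D" "C \<noteq> (D :: 'a \<times> 'a)"
    and eq: "\<And>v. place v \<Longrightarrow> v \<noteq> s \<Longrightarrow>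
      log_dist v A B + log_dist v C D = log_dist v A C + log_dist v B D"
    and w: "place w"
  shows "log_dist w A D + log_dist w B C = log_dist w A B + log_dist w C D"
proof -
  have nz: "homdet A B \<noteq> 0" "homdet A C \<noteq> 0" "homdet A D \<noteq> 0" "homdet B C \<noteq> 0" "homdet B D \<noteq> 0" "homdet C D \<noteq> 0"
    using P1 neq homdet_P1_eq_0_iff by blast+
  define x where "x = - (homdet A C * homdet B D) / (homdet A B * homdet C D)"
  have x1: "1 + x = - (homdet A D * homdet B C) / (homdet A B * homdet C D)"
  proof -
    have "1 + x = (homdet A B * homdet C D - homdet A C * homdet B D) / (homdet A B * homdet C D)"
      using nz by (simp add: x_def diff_divide_distrib)
    also have "homdet A B * homdet C D - homdet A C * homdet B D = - (homdet A D * homdet B C)"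
      using homdet_pluecker[of A B C D] by (simp add: eq_neg_iff_add_eq_0)
    finally show ?thesis .
  qed
  have "w (1 + x) = 0"
  proof (rule place_unit_outside_one_place[OF gff _ _ _ w])
    show "x \<noteq> 0" using nz by (simp add: x_def)
    show "1 + x \<noteq> 0" using nz by (simp add: x1)
    fix v assume v: "place v" "v \<noteq> s"
    show "v x = 0"
      using eq[OF v] nz by (simp add: x_def place_divide[OF v(1)] place_mult[OF v(1)] place_minus[OF v(1)] log_dist_homdet)
  qed
  then show ?thesis
    using nz by (simp add: x1 place_divide[OF w] place_mult[OF w] place_minus[OF w] log_dist_homdet)
qed

lemma funpow_mod_period:
  assumes "(\<phi> ^^ n) P = P"
  shows "(\<phi> ^^ (i mod n)) P = (\<phi> ^^ i) P"
proof -
  have "(\<phi> ^^ (n * k)) P = P" for k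
    using assms by (induction k) (auto simp: funpow_add)
  then show ?thesis
    by (metis comp_apply funpow_add mod_mult_div_eq)
qed

theorem theorem5p1:
  fixes d :: nat and f g :: "'a::field poly" and C :: "('a \<times> 'a) set"
  assumes "global_function_field TYPE('a)"
    and "hcoprime d f g"
    and "\<exists>!v. place v \<and> \<not> good_reduction v d f g"
    and "C \<subseteq> P1"
    and "is_cycle (ratmap d f g) C"
    and "card C > 1"
    and "place w" and "good_reduction w d f g"
  shows "\<exists>k::int. \<forall>P\<in>C. \<forall>Q\<in>C. P \<noteq> Q \<longrightarrow> log_dist w P Q = k"
proof -
  let ?\<phi> = "ratmap d f g"
  obtain v0 where v0: "\<And>v. place v \<Longrightarrow> v \<noteq> v0 \<Longrightarrow> good_reduction v d f g"
    using assms(3) by blast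
  \<comment> \<open>Contains every place except \<open>v0\<close>, so equalities at all members of
    \<open>V\<close> leave a single exceptional place.\<close>
  define V where "V = {v. place v \<and> good_reduction v d f g}"
  obtain P where per: "periodic_point ?\<phi> P" and C: "C = {(?\<phi> ^^ i) P | i. True}"
    using assms(5) unfolding is_cycle_def by blast
  define n where "n = (LEAST n. n \<ge> 1 \<and> (?\<phi> ^^ n) P = P)"
  have n: "n \<ge> 1" "(?\<phi> ^^ n) P = P"
    using LeastI_ex[OF per[unfolded periodic_point_def]] by (simp_all add: n_def)
  have n_min: "n \<le> m" if "m \<ge> 1" "(?\<phi> ^^ m) P = P" for m
    unfolding n_def using that by (intro Least_le) simp
  \<comment> \<open>The cycle is indexed by all integers, with period \<open>n\<close>, so that
    differences of indices need no case distinction.\<close>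
  define Q where "Q k = (?\<phi> ^^ nat (k mod int n)) P" for k :: int
  have Q_nat: "Q (int i) = (?\<phi> ^^ i) P" for i
    using funpow_mod_period[of n ?\<phi> P i, OF n(2)] by (simp add: Q_def flip: of_nat_mod)
  have Q_cong: "Q k = Q l" if "int n dvd k - l" for k l
  proof -
    have "k mod int n = l mod int n" using that by (simp add: mod_eq_dvd_iff)
    then show ?thesis by (simp add: Q_def)
  qed
  have Q_step: "?\<phi> (Q k) = Q (k + 1)" for k
  proof -
    have "?\<phi> (Q k) = Q (int (Suc (nat (k mod int n))))"
      by (subst Q_nat) (simp add: Q_def)
    also have "\<dots> = Q (k + 1)"
      using n(1) by (intro Q_cong) (simp add: mod_eq_dvd_iff[symmetric] mod_simps algebra_simps)
    finally show ?thesis .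
  qed
  have Q_shift: "(?\<phi> ^^ m) (Q k) = Q (k + int m)" for m k
    by (induction m) (auto simp: Q_step algebra_simps)
  have Q_C: "Q k \<in> C" for k
    by (auto simp: C Q_def)
  then have Q_P1: "Q k \<in> P1" for k
    using assms(4) by blast
  have Q_eq_0: "int n dvd k" if "Q k = Q 0" for k
  proof (rule ccontr)
    assume "\<not> int n dvd k"
    then have "k mod int n \<noteq> 0" "0 \<le> k mod int n" "k mod int n < int n"
      using n(1) by (auto simp: dvd_eq_mod_eq_0)
    then have "1 \<le> nat (k mod int n)" "nat (k mod int n) < n" by linarith+
    moreover have "(?\<phi> ^^ nat (k mod int n)) P = P"
      using that Q_nat[of 0] by (simp add: Q_def)
    ultimately show False using n_min leD by blast
  qed
  \<comment> \<open>The map can only be iterated forwards, so \<open>l\<close> is moved to a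
    multiple of \<open>n\<close> by adding \<open>m\<close>.\<close>
  have Q_eq: "int n dvd k - l" if "Q k = Q l" for k l
  proof -
    define m where "m = nat ((- l) mod int n)"
    have m: "int n dvd l + int m"
      using n(1) by (simp add: m_def dvd_eq_mod_eq_0 mod_simps)
    have "Q (k + int m) = Q (l + int m)"
      using that Q_shift by metis
    also have "\<dots> = Q 0" using m by (intro Q_cong) simp
    finally have "int n dvd k + int m" by (rule Q_eq_0)
    from dvd_diff[OF this m] show ?thesis by simp
  qed
  have Q_iff: "Q k = Q l \<longleftrightarrow> int n dvd k - l" for k l
    using Q_eq Q_cong by blast
  have Q_iff': "Q k = Q l \<longleftrightarrow> int n dvd l - k" for k l
    using Q_iff[of l k] by auto
  have C_Q: "\<exists>k. A = Q k" if "A \<in> C" for A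
    using that Q_nat by (auto simp: C) metis
  have n_gt_1: "n > 1"
  proof (rule ccontr)
    assume "\<not> n > 1"
    then have "n = 1" using n by simp
    have "C \<subseteq> {Q 0}"
    proof
      fix A assume "A \<in> C"
      then obtain k where "A = Q k" using C_Q by blast
      moreover have "Q k = Q 0" using \<open>n = 1\<close> by (intro Q_cong) simp
      ultimately show "A \<in> {Q 0}" by simp
    qed
    then have "card C \<le> 1" using card_mono[of "{Q 0}" C] by simp
    with assms(6) show False by simp
  qed
  \<comment> \<open>A map of degree \<open>0\<close> is constant, so it has no cycle with more than
    one point.\<close>
  have d: "d > 0"
  proof (rule ccontr)
    assume "\<not> d > 0"
    then have "?\<phi> (Q 0) = ?\<phi> (Q 1)" by (simp add: ratmap_def hform_def)
    then have "Q 1 = Q 2" using Q_step[of 0] Q_step[of 1] by simp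
    then show False using n_gt_1 by (auto simp: Q_iff)
  qed
  have step: "log_dist v (Q k) (Q l) \<le> log_dist v (Q (k + 1)) (Q (l + 1))"
    if "v \<in> V" "\<not> int n dvd k - l" for v k l
  proof -
    have "?\<phi> (Q k) \<noteq> ?\<phi> (Q l)" using that(2) by (simp add: Q_step Q_iff)
    then show ?thesis
      using good_reduction_log_dist_le[of v d f g "Q k" "Q l"] that(1) d Q_P1
      by (simp add: V_def Q_step)
  qed
  have steps: "log_dist v (Q k) (Q l) \<le> log_dist v (Q (k + int m)) (Q (l + int m))"
    if "v \<in> V" "\<not> int n dvd k - l" for v k l m
  proof (induction m)
    case (Suc m)
    then show ?case
      using step[OF that(1), of "k + int m" "l + int m"] that(2) by (simp add: algebra_simps)
  qed simp
  \<comment> \<open>Continuing around the cycle by \<open>r\<close> further steps returns to the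
    starting pair, so the chain of inequalities closes up to an equality.\<close>
  have shift: "log_dist v (Q (k + int m)) (Q (l + int m)) = log_dist v (Q k) (Q l)"
    if v: "v \<in> V" and kl: "\<not> int n dvd k - l" for v k l m
  proof -
    define r where "r = nat ((- int m) mod int n)"
    have r: "int n dvd int m + int r"
      using n(1) by (simp add: r_def dvd_eq_mod_eq_0 mod_simps)
    have "log_dist v (Q (k + int m)) (Q (l + int m)) \<le> log_dist v (Q (k + int m + int r)) (Q (l + int m + int r))"
      using v kl by (intro steps) auto
    also have "Q (k + int m + int r) = Q k"
      using r by (simp add: Q_iff algebra_simps)
    also have "Q (l + int m + int r) = Q l"
      using r by (simp add: Q_iff algebra_simps)
    finally show ?thesis using steps[OF v kl, of m] by simp
  qed
  define e where "e v k = log_dist v (Q 0) (Q k)" for v k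
  have dist: "log_dist v (Q k) (Q l) = e v (l - k)" if v: "v \<in> V" and kl: "\<not> int n dvd l - k" for v k l
  proof -
    define m where "m = nat ((- k) mod int n)"
    have m: "int n dvd k + int m"
      using n(1) by (simp add: m_def dvd_eq_mod_eq_0 mod_simps)
    have "log_dist v (Q k) (Q l) = log_dist v (Q (k + int m)) (Q (l + int m))"
      using v kl by (intro shift[symmetric]) (auto simp: dvd_diff_commute)
    also have "Q (k + int m) = Q 0"
      using m by (simp add: Q_iff)
    also have "Q (l + int m) = Q (l - k)"
      using m by (simp add: Q_iff algebra_simps)
    finally show ?thesis by (simp add: e_def)
  qed
  interpret cycle_distances V e "int n"
  proof
    show "int n > 1" using n_gt_1 by simp
  next
    fix v k assume v: "v \<in> V" and k: "\<not> int n dvd k"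
    have "e v (- k) = log_dist v (Q k) (Q 0)" using dist[OF v, of 0 k] k by simp
    also have "\<dots> = e v k" using v log_dist_commute[of v] by (simp add: e_def V_def)
    finally show "e v (- k) = e v k" .
  next
    fix v k l assume "v \<in> V" "int n dvd k - l"
    then show "e v k = e v l" using Q_cong by (simp add: e_def)
  next
    fix v j k assume v: "v \<in> V" and nd: "\<not> int n dvd j" "\<not> int n dvd k" "\<not> int n dvd j + k"
    have "min (log_dist v (Q 0) (Q j)) (log_dist v (Q j) (Q (j + k))) \<le> log_dist v (Q 0) (Q (j + k))"
      using v nd Q_P1 by (intro log_dist_ultra) (auto simp: V_def Q_iff')
    then show "min (e v j) (e v k) \<le> e v (j + k)"
      using dist[OF v, of "j + k" j] nd by (simp add: e_def)
  next
    fix a b c v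
    assume nd: "\<not> int n dvd a" "\<not> int n dvd b" "\<not> int n dvd c"
        "\<not> int n dvd b - a" "\<not> int n dvd c - a" "\<not> int n dvd c - b"
      and eq: "\<And>v. v \<in> V \<Longrightarrow> e v a + e v (c - b) = e v b + e v (c - a)"
      and v: "v \<in> V"
    \<comment> \<open>The four points are \<open>Q 0\<close>, \<open>Q a\<close>,
      \<open>Q b\<close>, \<open>Q c\<close>, and the exceptional place is the bad one.\<close>
    have "log_dist v (Q 0) (Q c) + log_dist v (Q a) (Q b) = log_dist v (Q 0) (Q a) + log_dist v (Q b) (Q c)"
    proof (rule homdet_cross[OF assms(1), where s = v0])
      fix u assume "place u" "u \<noteq> v0"
      then have u: "u \<in> V" using v0 by (simp add: V_def)
      show "log_dist u (Q 0) (Q a) + log_dist u (Q b) (Q c) = log_dist u (Q 0) (Q b) + log_dist u (Q a) (Q c)"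
        using eq[OF u] nd by (simp add: dist[OF u])
    qed (use nd v Q_P1 in \<open>auto simp: Q_iff' V_def\<close>)
    then show "e v c + e v (b - a) = e v a + e v (c - b)"
      using nd by (simp add: dist[OF v])
  qed
  have w: "w \<in> V" using assms by (simp add: V_def)
  show ?thesis
  proof (intro exI[of _ "e w 1"] ballI impI)
    fix A B assume AB: "A \<in> C" "B \<in> C" "A \<noteq> B"
    obtain k l where kl: "A = Q k" "B = Q l" using C_Q AB by blast
    then have "\<not> int n dvd l - k" using AB(3) by (auto simp: Q_iff')
    then show "log_dist w A B = e w 1"
      unfolding kl by (simp add: dist[OF w] e_const[OF w])
  qed
qed

end
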